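(* Let $(M,\mathfrak{F})$ be a compact $(\mathsf{L}_{\mathsf u}^*(n),\mathbb{R}^{n+1})$-foliated manifold. Then the leaves of $\mathfrak{F}$ are $(\mathsf{L}_{\mathsf u}^*(n),\mathbb{R}^{n+1})$-complete.
   Context: $\mathsf{L}_{\mathsf u}^*(n)$ is the subgroup of the affine group of $\mathbb{R}^{n+1}$ consisting of all affine maps with arbitrary translation part and linear part of the form $\begin{pmatrix}A&\beta\\0&1\end{pmatrix}$, $\beta\in\mathbb{R}^n$, $A\in \mathsf{O}(n)$. Let $G$ be a Lie group acting transitively by real analytic diffeomorphisms on $X$. A $(G,X)$-structure on a manifold is an atlas of charts into $X$ whose transition maps are restrictions of elements of $G$. It yields a developing map, a local diffeomorphism $\mathsf{Dev}$ from the universal cover to $X$, equivariant with respect to a holonomy representation of the fundamental group into $G$. A $(G,X)$-manifold is $(G,X)$-complete if $\mathsf{Dev}$ is a covering map onto $X$. A $(G,X)$-foliated manifold $(M,\mathfrak{F})$ is a smooth manifold $M$ with a foliation $\mathfrak{F}$ of codimension $k$ such that every $p\in M$ has an open neighborhood $U$ and a diffeomorphism onto its image $\varphi:U\to\mathbb{R}^k\times X$ mapping every leaf of the foliation induced by $\mathfrak{F}$ on $U$ to a level $\{t\}\times V_t$, $V_t\subset X$, and such that for two such maps $\varphi_i,\varphi_j$ the transition map $\varphi_j\varphi_i^{-1}$ has the form $(t,x)\mapsto(\psi(t),g_t(x))$ with $g_t\in G$. In particular each leaf of $\mathfrak{F}$ inherits a $(G,X)$-structure. *)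

theory Defs
  imports "HOL-Analysis.Analysis"
begin

text \<open>
  The space \<open>\<real>\<^sup>m\<close> is the library's \<^const>\<open>Euclidean_space\<close> \<open>m\<close>, i.e. the sequences
  \<open>nat \<Rightarrow> real\<close> supported on \<open>{..<m}\<close>. Dimensions are thus natural numbers, including 0 (a foliation
  of codimension 0 has the components of the manifold as its leaves). Coordinates are numbered from 0.
\<close>

section \<open>Smooth manifolds\<close>

text \<open>\<open>C\<^sup>r\<close> and \<open>C\<^sup>\<infinity>\<close> real-valued functions on an open subset \<open>S\<close> of \<open>\<real>\<^sup>m\<close>.\<close>

primrec cr_on :: "nat \<Rightarrow> nat \<Rightarrow> (nat \<Rightarrow> real) set \<Rightarrow> ((nat \<Rightarrow> real) \<Rightarrow> real) \<Rightarrow> bool" where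
  "cr_on m 0 S f \<longleftrightarrow> continuous_map (subtopology (Euclidean_space m) S) euclideanreal f"
| "cr_on m (Suc r) S f \<longleftrightarrow>
     continuous_map (subtopology (Euclidean_space m) S) euclideanreal f \<and>
     (\<forall>i<m. \<exists>f'. (\<forall>x\<in>S. ((\<lambda>s. f (x(i := s))) has_real_derivative f' x) (at (x i))) \<and> cr_on m r S f')"

definition smooth_on :: "nat \<Rightarrow> (nat \<Rightarrow> real) set \<Rightarrow> ((nat \<Rightarrow> real) \<Rightarrow> real) \<Rightarrow> bool" where
  "smooth_on m S f \<longleftrightarrow> (\<forall>r. cr_on m r S f)"

type_synonym 'a chart = "'a set \<times> ('a \<Rightarrow> nat \<Rightarrow> real)"

definition is_chart :: "nat \<Rightarrow> 'a topology \<Rightarrow> 'a chart \<Rightarrow> bool" where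
  "is_chart m M c \<longleftrightarrow> (case c of (U, \<phi>) \<Rightarrow>
     openin M U \<and> openin (Euclidean_space m) (\<phi> ` U) \<and>
     homeomorphic_map (subtopology M U) (subtopology (Euclidean_space m) (\<phi> ` U)) \<phi>)"

definition smooth_transition :: "nat \<Rightarrow> 'a chart \<Rightarrow> 'a chart \<Rightarrow> bool" where
  "smooth_transition m c c' \<longleftrightarrow> (case (c, c') of ((U, \<phi>), (V, \<psi>)) \<Rightarrow>
     (\<forall>i<m. smooth_on m (\<phi> ` (U \<inter> V)) (\<lambda>z. \<psi> (inv_into U \<phi> z) i)))"

definition smooth_manifold :: "nat \<Rightarrow> 'a topology \<Rightarrow> 'a chart set \<Rightarrow> bool" where
  "smooth_manifold m M A \<longleftrightarrow>
     Hausdorff_space M \<and> second_countable M \<and>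
     (\<forall>c\<in>A. is_chart m M c) \<and> topspace M \<subseteq> (\<Union>c\<in>A. fst c) \<and>
     (\<forall>c\<in>A. \<forall>c'\<in>A. smooth_transition m c c')"

text \<open>\<open>(U, \<phi>)\<close> with \<open>U\<close> open in the manifold and \<open>\<phi>\<close> a diffeomorphism of \<open>U\<close> onto an open subset
  of \<open>\<real>\<^sup>m\<close>.\<close>

definition diffeo_chart :: "nat \<Rightarrow> 'a topology \<Rightarrow> 'a chart set \<Rightarrow> 'a chart \<Rightarrow> bool" where
  "diffeo_chart m M A c \<longleftrightarrow>
     is_chart m M c \<and> (\<forall>c'\<in>A. smooth_transition m c c' \<and> smooth_transition m c' c)"

section \<open>Foliations\<close>

text \<open>The product \<open>\<real>\<^sup>k \<times> \<real>\<^sup>d\<close> is \<open>\<real>\<^sup>(\<^sup>k\<^sup>+\<^sup>d\<^sup>)\<close>; these are its two projections.\<close>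

definition tpart :: "nat \<Rightarrow> (nat \<Rightarrow> real) \<Rightarrow> nat \<Rightarrow> real" where
  "tpart k z = (\<lambda>i. if i < k then z i else 0)"

definition xpart :: "nat \<Rightarrow> (nat \<Rightarrow> real) \<Rightarrow> nat \<Rightarrow> real" where
  "xpart k z = (\<lambda>i. z (k + i))"

text \<open>
  A foliation is given by the set \<open>F\<close> of its leaves. The leaves of the foliation induced on an open
  set \<open>U\<close> are the path components of the sets \<open>L \<inter> U\<close>, \<open>L \<in> F\<close>. (A path of \<open>M\<close> that stays in a leaf is
  continuous for the manifold topology of that leaf, so the subspace topology and the leaf
  topology have the same path components here.)
\<close>

definition local_leaves :: "'a topology \<Rightarrow> 'a set \<Rightarrow> 'a set \<Rightarrow> 'a set set" where
  "local_leaves M L U = path_components_of (subtopology M (L \<inter> U))"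

definition maps_leaves_to_levels ::
  "nat \<Rightarrow> nat \<Rightarrow> 'a topology \<Rightarrow> 'a set set \<Rightarrow> 'a chart \<Rightarrow> bool" where
  "maps_leaves_to_levels k d M F c \<longleftrightarrow> (case c of (U, \<phi>) \<Rightarrow>
     (\<forall>L\<in>F. \<forall>C\<in>local_leaves M L U. \<exists>t V. openin (Euclidean_space d) V \<and>
        \<phi> ` C = {z \<in> topspace (Euclidean_space (k + d)). tpart k z = t \<and> xpart k z \<in> V}))"

text \<open>Foliations of codimension \<open>k\<close> and leaf dimension \<open>d\<close>.\<close>

definition foliation ::
  "nat \<Rightarrow> nat \<Rightarrow> 'a topology \<Rightarrow> 'a chart set \<Rightarrow> 'a set set \<Rightarrow> bool" where
  "foliation k d M A F \<longleftrightarrow>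
     partition_on (topspace M) F \<and> (\<forall>L\<in>F. path_connectedin M L) \<and>
     (\<forall>p\<in>topspace M. \<exists>c. p \<in> fst c \<and> diffeo_chart (k + d) M A c \<and> maps_leaves_to_levels k d M F c)"

text \<open>The manifold topology of a leaf, in general finer than its subspace topology.\<close>

definition leaf_topology :: "'a topology \<Rightarrow> 'a set \<Rightarrow> 'a topology" where
  "leaf_topology M L = topology_generated_by (\<Union>W\<in>{W. openin M W}. local_leaves M L W)"

section \<open>\<open>(G, X)\<close>-structures, for \<open>X = \<real>\<^sup>d\<close>\<close>

type_synonym trafo = "(nat \<Rightarrow> real) \<Rightarrow> nat \<Rightarrow> real"

definition gx_structure :: "nat \<Rightarrow> trafo set \<Rightarrow> 'a topology \<Rightarrow> 'a chart set \<Rightarrow> bool" where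
  "gx_structure d G N A \<longleftrightarrow>
     (\<forall>c\<in>A. is_chart d N c) \<and> topspace N \<subseteq> (\<Union>c\<in>A. fst c) \<and>
     (\<forall>(U, \<phi>)\<in>A. \<forall>(V, \<psi>)\<in>A. \<exists>g\<in>G. \<forall>p\<in>U \<inter> V. \<psi> p = g (\<phi> p))"

text \<open>The counterparts of \<^const>\<open>covering_space\<close> and \<^const>\<open>simply_connected\<close> for abstract
  topologies.\<close>

definition covering_map :: "'a topology \<Rightarrow> ('a \<Rightarrow> 'b) \<Rightarrow> 'b topology \<Rightarrow> bool" where
  "covering_map E p B \<longleftrightarrow>
     continuous_map E B p \<and> p ` topspace E = topspace B \<and>
     (\<forall>b\<in>topspace B. \<exists>T. b \<in> T \<and> openin B T \<and>
        (\<exists>\<V>. \<Union>\<V> = {x \<in> topspace E. p x \<in> T} \<and> (\<forall>V\<in>\<V>. openin E V) \<and> pairwise disjnt \<V> \<and>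
             (\<forall>V\<in>\<V>. homeomorphic_map (subtopology E V) (subtopology B T) p)))"

definition simply_connected_space :: "'a topology \<Rightarrow> bool" where
  "simply_connected_space E \<longleftrightarrow>
     path_connected_space E \<and>
     (\<forall>p. pathin E p \<and> p 1 = p 0 \<longrightarrow>
        homotopic_with (\<lambda>r. r 1 = r 0) (top_of_set {0..1}) E p (\<lambda>_. p 0))"

definition universal_cover :: "'u topology \<Rightarrow> ('u \<Rightarrow> 'a) \<Rightarrow> 'a topology \<Rightarrow> bool" where
  "universal_cover E \<pi> N \<longleftrightarrow> simply_connected_space E \<and> covering_map E \<pi> N"

text \<open>
  A developing map is a map of \<open>(G, X)\<close>-manifolds from the universal cover to \<open>X\<close>: locally it is a
  chart of \<open>N\<close> followed by an element of \<open>G\<close>. It is in particular a local homeomorphism, and it is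
  equivariant for a holonomy representation; it is unique up to composition with elements of \<open>G\<close>.
\<close>

definition developing_map ::
  "trafo set \<Rightarrow> 'a chart set \<Rightarrow> 'u topology \<Rightarrow> ('u \<Rightarrow> 'a) \<Rightarrow> ('u \<Rightarrow> nat \<Rightarrow> real) \<Rightarrow> bool" where
  "developing_map G A E \<pi> Dev \<longleftrightarrow>
     (\<forall>u\<in>topspace E. \<exists>W. openin E W \<and> u \<in> W \<and>
        (\<exists>(U, \<phi>)\<in>A. \<exists>g\<in>G. \<pi> ` W \<subseteq> U \<and> (\<forall>w\<in>W. Dev w = g (\<phi> (\<pi> w)))))"

text \<open>
  Completeness is expressed for all universal covers and all developing maps. HOL cannot quantify
  over the type carrying the universal cover inside a definition, so this type is a parameter \<open>'u\<close>.
  Universal covers being unique up to isomorphism, any \<open>'u\<close> large enough to carry one gives the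
  usual notion, for example \<open>(real \<Rightarrow> 'a) set\<close> (classes of paths); a result about completeness should
  be stated for arbitrary \<open>'u\<close>.
\<close>

definition gx_complete ::
  "'u itself \<Rightarrow> nat \<Rightarrow> trafo set \<Rightarrow> 'a topology \<Rightarrow> 'a chart set \<Rightarrow> bool" where
  "gx_complete (_ :: 'u itself) d G N A \<longleftrightarrow>
     gx_structure d G N A \<and>
     (\<forall>(E :: 'u topology) \<pi> Dev. universal_cover E \<pi> N \<and> developing_map G A E \<pi> Dev \<longrightarrow>
        covering_map E Dev (Euclidean_space d))"

section \<open>\<open>(G, X)\<close>-foliated manifolds, for \<open>X = \<real>\<^sup>d\<close>\<close>

definition gx_transition :: "nat \<Rightarrow> trafo set \<Rightarrow> 'a chart \<Rightarrow> 'a chart \<Rightarrow> bool" where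
  "gx_transition k G c c' \<longleftrightarrow> (case (c, c') of ((U, \<phi>), (V, \<psi>)) \<Rightarrow>
     (\<exists>h g. (\<forall>t. g t \<in> G) \<and>
        (\<forall>p\<in>U \<inter> V. tpart k (\<psi> p) = h (tpart k (\<phi> p)) \<and>
                   xpart k (\<psi> p) = g (tpart k (\<phi> p)) (xpart k (\<phi> p)))))"

text \<open>\<open>A\<close> is an atlas for the smooth structure of \<open>M\<close>, and \<open>B\<close> is the atlas of maps to
  \<open>\<real>\<^sup>k \<times> X\<close>.\<close>

definition gx_foliated_manifold ::
  "nat \<Rightarrow> nat \<Rightarrow> trafo set \<Rightarrow> 'a topology \<Rightarrow> 'a chart set \<Rightarrow> 'a set set \<Rightarrow> 'a chart set \<Rightarrow> bool" where
  "gx_foliated_manifold k d G M A F B \<longleftrightarrow>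
     smooth_manifold (k + d) M A \<and> foliation k d M A F \<and>
     topspace M \<subseteq> (\<Union>c\<in>B. fst c) \<and>
     (\<forall>c\<in>B. diffeo_chart (k + d) M A c \<and> maps_leaves_to_levels k d M F c) \<and>
     (\<forall>c\<in>B. \<forall>c'\<in>B. gx_transition k G c c')"

text \<open>The \<open>(G, X)\<close>-structure inherited by a leaf \<open>L\<close>.\<close>

definition leaf_atlas :: "nat \<Rightarrow> 'a topology \<Rightarrow> 'a chart set \<Rightarrow> 'a set \<Rightarrow> 'a chart set" where
  "leaf_atlas k M B L =
     {(C, \<lambda>p. xpart k (\<phi> p)) | C U \<phi>. (U, \<phi>) \<in> B \<and> C \<in> local_leaves M L U}"

section \<open>The group \<open>L\<^sub>u\<^sup>*(n)\<close>\<close>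

definition affine_map :: "nat \<Rightarrow> (nat \<Rightarrow> nat \<Rightarrow> real) \<Rightarrow> (nat \<Rightarrow> real) \<Rightarrow> trafo" where
  "affine_map m a v x = (\<lambda>i. if i < m then (\<Sum>j<m. a i j * x j) + v i else 0)"

definition Lu_star :: "nat \<Rightarrow> trafo set" where
  "Lu_star n = {affine_map (Suc n) a v | a v.
     (\<forall>i<n. \<forall>j<n. (\<Sum>l<n. a l i * a l j) = (if i = j then 1 else 0)) \<and>
     (\<forall>j<n. a n j = 0) \<and> a n n = 1}"

end

theory Submission
  imports Defs "Jordan_Normal_Form.Determinant"
begin

text \<open>
  Let \<open>D\<close> be a developing map of a leaf \<open>L\<close>, defined on the universal cover \<open>E\<close> of \<open>L\<close>. An element of the
  group translates the last coordinate, and it acts by Euclidean isometries between the horizontal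
  hyperplanes, on which the last coordinate is constant. It may shear these hyperplanes against each
  other by an arbitrary amount, so no invariant metric on the leaf is at hand, and the proof treats
  the horizontal directions and the last coordinate differently.

  Compactness of \<open>M\<close> gives a \<open>\<delta> > 0\<close> such that every point of \<open>L\<close> is the centre of a plaque
  containing, in its chart, a box of radius \<open>\<delta>\<close> (\<open>uniform_chart_size\<close>, \<open>plaque_contains_box\<close>). The box
  lifts to \<open>E\<close>, and on the lift \<open>D\<close> is the chart followed by a fixed affine map, because affine maps
  are determined by their germs. Consequently, with \<open>\<epsilon> = \<delta> / 2\<close>, through every point \<open>u\<close> of \<open>E\<close> there
  is a section of \<open>D\<close> over a cylinder of radius \<open>\<epsilon>\<close> and half-height \<open>\<epsilon>\<close> around \<open>D u\<close> whose axis is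
  tilted by an unknown slope (\<open>developing_map_section\<close>).

  These sections can be continued horizontally without end: at each point of a level a disc of radius
  \<open>\<epsilon>\<close> in the same level is available, regardless of the slopes. This yields a section over the whole
  slab of half-height \<open>\<epsilon>\<close> around the level of \<open>D u\<close> (\<open>widen_section\<close>, \<open>slab_section\<close>). In the slab
  the slopes are no longer visible, so the slabs of half-height \<open>\<epsilon> / 2\<close> are evenly covered, and
  \<open>D\<close> is a covering map onto \<open>\<real>\<^sup>n\<^sup>+\<^sup>1\<close> (\<open>covering_map_if_scyl_sections\<close>).

  Both continuations of sections, through coverings and along horizontal levels, are instances of
  \<open>extend_section\<close>.
\<close>

section \<open>Convex and connected sets\<close>

definition seg :: "real \<Rightarrow> (nat \<Rightarrow> real) \<Rightarrow> (nat \<Rightarrow> real) \<Rightarrow> nat \<Rightarrow> real" where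
  "seg t x y = (\<lambda>i. (1 - t) * x i + t * y i)"

definition cvx :: "(nat \<Rightarrow> real) set \<Rightarrow> bool" where
  "cvx C \<longleftrightarrow> (\<forall>x\<in>C. \<forall>y\<in>C. \<forall>t\<in>{0..1}. seg t x y \<in> C)"

lemma cvx_Int: "cvx C \<Longrightarrow> cvx D \<Longrightarrow> cvx (C \<inter> D)"
  by (auto simp: cvx_def)

lemma seg_0 [simp]: "seg 0 x y = x" and seg_1 [simp]: "seg 1 x y = y"
  by (auto simp: seg_def)

lemma Euclidean_space_eq: "Euclidean_space m = top_of_set (topspace (Euclidean_space m))"
  by (simp add: Euclidean_space_def euclidean_product_topology)

lemma openin_Euclidean_space_Int_open:
  "open T \<Longrightarrow> openin (Euclidean_space m) (topspace (Euclidean_space m) \<inter> T)"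
  by (metis Euclidean_space_eq openin_open)

lemma path_connectedin_cvx:
  assumes "cvx C" "C \<subseteq> topspace (Euclidean_space m)"
  shows "path_connectedin (Euclidean_space m) C"
proof -
  have "path_connectedin euclidean C"
    unfolding path_connectedin
  proof (intro conjI ballI)
    fix x y assume xy: "x \<in> C" "y \<in> C"
    have "continuous_on {0..1} (\<lambda>t. seg t x y)"
      unfolding seg_def by (intro continuous_on_coordinatewise_then_product continuous_intros)
    then have "pathin euclidean (\<lambda>t. seg t x y)"
      by (simp add: pathin_def)
    then show "\<exists>g. pathin euclidean g \<and> g \<in> {0..1} \<rightarrow> C \<and> g 0 = x \<and> g 1 = y"
      using xy assms(1) by (intro exI[of _ "\<lambda>t. seg t x y"]) (auto simp: cvx_def)
  qed auto
  then show ?thesis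
    by (metis Euclidean_space_eq assms(2) path_connectedin_subtopology)
qed

lemma connectedin_cvx:
  "cvx C \<Longrightarrow> C \<subseteq> topspace (Euclidean_space m) \<Longrightarrow> connectedin (Euclidean_space m) C"
  by (simp add: path_connectedin_cvx path_connectedin_imp_connectedin)

text \<open>Otherwise \<open>V\<close> and the union of the separating sets would disconnect \<open>\<Omega>\<close>.\<close>

lemma connectedin_subset_if_separated:
  assumes "connectedin X \<Omega>" "openin X V" "p \<in> \<Omega>" "p \<in> V"
    and sep: "\<And>x. x \<in> \<Omega> \<Longrightarrow> x \<notin> V \<Longrightarrow> \<exists>T. openin X T \<and> x \<in> T \<and> T \<inter> V = {}"
  shows "\<Omega> \<subseteq> V"
proof (rule ccontr)
  assume "\<not> \<Omega> \<subseteq> V"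
  then obtain x where x: "x \<in> \<Omega>" "x \<notin> V" by blast
  define W where "W = \<Union>{T. openin X T \<and> T \<inter> V = {}}"
  have "openin X W" unfolding W_def by blast
  moreover have "W \<inter> V = {}" unfolding W_def by blast
  moreover have "\<Omega> \<subseteq> V \<union> W"
  proof
    fix z assume z: "z \<in> \<Omega>"
    show "z \<in> V \<union> W"
    proof (cases "z \<in> V")
      case False
      from sep[OF z this] show ?thesis unfolding W_def by blast
    qed simp
  qed
  moreover have "W \<inter> \<Omega> \<noteq> {}"
    using sep[OF x] x(1) unfolding W_def by blast
  ultimately show False
    using assms(1-4) unfolding connectedin by blast
qed

section \<open>Local sections of local homeomorphisms\<close>

definition locally_injective :: "'u topology \<Rightarrow> ('u \<Rightarrow> 'b) \<Rightarrow> bool" where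
  "locally_injective E D \<longleftrightarrow> (\<forall>u\<in>topspace E. \<exists>W. openin E W \<and> u \<in> W \<and> inj_on D W)"

text \<open>Sections are the objects that get continued here, in place of paths: a connected set is evenly
  covered by a local homeomorphism when sections over it pass through all points above it. The
  domain is open by definition, so that the image of a section is an open sheet.\<close>

definition section_over ::
  "'u topology \<Rightarrow> ('u \<Rightarrow> 'b) \<Rightarrow> 'b topology \<Rightarrow> 'b set \<Rightarrow> ('b \<Rightarrow> 'u) \<Rightarrow> bool" where
  "section_over E D X C \<sigma> \<longleftrightarrow>
     openin X C \<and> continuous_map (subtopology X C) E \<sigma> \<and> (\<forall>x\<in>C. D (\<sigma> x) = x)"

lemma section_over_in_topspace: "section_over E D X C \<sigma> \<Longrightarrow> x \<in> C \<Longrightarrow> \<sigma> x \<in> topspace E"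
  by (auto simp: section_over_def continuous_map_def Pi_iff openin_subset dest: openin_subset)

lemma section_over_subset:
  "section_over E D X C \<sigma> \<Longrightarrow> openin X C' \<Longrightarrow> C' \<subseteq> C \<Longrightarrow> section_over E D X C' \<sigma>"
  unfolding section_over_def using continuous_map_from_subtopology_mono by blast

text \<open>The set where the two sections agree is closed because \<open>E\<close> is Hausdorff, and open because \<open>D\<close> is
  locally injective.\<close>

lemma sections_eq:
  assumes E: "Hausdorff_space E" "locally_injective E D"
    and s: "section_over E D X C \<sigma>" and t: "section_over E D X C' \<tau>"
    and con: "connectedin X (C \<inter> C')" and x0: "x0 \<in> C" "x0 \<in> C'" "\<sigma> x0 = \<tau> x0"
    and x: "x \<in> C" "x \<in> C'"
  shows "\<sigma> x = \<tau> x"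
proof -
  let ?K = "C \<inter> C'"
  let ?X = "subtopology X ?K"
  have op: "openin X C" "openin X C'" using s t by (auto simp: section_over_def)
  then have top: "topspace ?X = ?K" by (auto dest: openin_subset)
  have cs: "continuous_map ?X E \<sigma>" "continuous_map ?X E \<tau>"
    using s t unfolding section_over_def by (blast intro: continuous_map_from_subtopology_mono)+
  let ?A = "{y \<in> topspace ?X. \<sigma> y = \<tau> y}"
  have "closedin ?X ?A"
    by (rule closedin_continuous_maps_eq[OF E(1) cs])
  moreover have "openin ?X ?A"
  proof (subst openin_subopen, intro ballI)
    fix y assume y: "y \<in> ?A"
    then have "\<sigma> y \<in> topspace E"
      using s top section_over_in_topspace by fastforce
    then obtain W where W: "openin E W" "\<sigma> y \<in> W" "inj_on D W"
      using E(2) by (auto simp: locally_injective_def)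
    let ?O = "{z \<in> topspace ?X. \<sigma> z \<in> W} \<inter> {z \<in> topspace ?X. \<tau> z \<in> W}"
    have "openin ?X ?O"
      using cs W(1) by (intro openin_Int openin_continuous_map_preimage)
    moreover have "?O \<subseteq> ?A"
    proof
      fix z assume z: "z \<in> ?O"
      then have "D (\<sigma> z) = D (\<tau> z)" using s t top by (simp add: section_over_def)
      with z W(3) show "z \<in> ?A" by (auto dest: inj_onD)
    qed
    moreover have "y \<in> ?O" using y W(2) by auto
    ultimately show "\<exists>T. openin ?X T \<and> y \<in> T \<and> T \<subseteq> ?A" by blast
  qed
  moreover have "connected_space ?X"
    using con by (simp add: connectedin_def)
  moreover have "x0 \<in> ?A" using x0 top by auto
  ultimately have "?A = topspace ?X"
    unfolding connected_space_clopen_in by blast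
  with x top show ?thesis by blast
qed

lemma section_over_UN:
  assumes sec: "\<And>i. i \<in> I \<Longrightarrow> section_over E D X (C i) (\<sigma> i)"
    and agree: "\<And>i j x. i \<in> I \<Longrightarrow> j \<in> I \<Longrightarrow> x \<in> C i \<Longrightarrow> x \<in> C j \<Longrightarrow> \<sigma> i x = \<sigma> j x"
  obtains \<tau> where "section_over E D X (\<Union>i\<in>I. C i) \<tau>"
    "\<And>i x. i \<in> I \<Longrightarrow> x \<in> C i \<Longrightarrow> \<tau> x = \<sigma> i x"
proof -
  let ?U = "\<Union>i\<in>I. C i"
  have op: "openin X (C i)" if "i \<in> I" for i
    using sec that by (auto simp: section_over_def)
  then have opU: "openin X ?U" by blast
  then have top: "topspace (subtopology X ?U) = ?U" using openin_subset by fastforce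
  have sub: "subtopology (subtopology X ?U) (C i) = subtopology X (C i)" if "i \<in> I" for i
    using that by (simp add: subtopology_subtopology) (metis UN_upper inf.absorb2)
  obtain \<tau> where \<tau>: "continuous_map (subtopology X ?U) E \<tau>"
      "\<And>x i. \<lbrakk>i \<in> I; x \<in> topspace (subtopology X ?U) \<inter> C i\<rbrakk> \<Longrightarrow> \<tau> x = \<sigma> i x"
  proof (rule pasting_lemma_exists[where X="subtopology X ?U" and I=I and T=C and Y=E and f=\<sigma>])
    show "openin (subtopology X ?U) (C i)" if "i \<in> I" for i
      using op[OF that] that openin_open_subtopology[OF opU] by auto
    show "continuous_map (subtopology (subtopology X ?U) (C i)) E (\<sigma> i)" if "i \<in> I" for i
      using sec[OF that] sub[OF that] by (simp add: section_over_def)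
    show "topspace (subtopology X ?U) \<subseteq> ?U" by (simp only: top subset_refl)
    show "\<sigma> i x = \<sigma> j x" if "i \<in> I" "j \<in> I" "x \<in> topspace (subtopology X ?U) \<inter> C i \<inter> C j" for i j x
      using agree[OF that(1,2)] that(3) by blast
  qed (erule that, blast)
  have *: "\<tau> x = \<sigma> i x" if "i \<in> I" "x \<in> C i" for i x
    using \<tau>(2)[OF that(1)] that top by blast
  show ?thesis
  proof
    show "section_over E D X ?U \<tau>"
      unfolding section_over_def
    proof (intro conjI ballI)
      show "openin X ?U" by (rule opU)
      show "continuous_map (subtopology X ?U) E \<tau>" by (rule \<tau>(1))
      fix x assume "x \<in> ?U"
      then obtain i where "i \<in> I" "x \<in> C i" by blast
      then show "D (\<tau> x) = x" using * sec by (simp add: section_over_def)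
    qed
  qed (rule *)
qed

text \<open>The continuation step. A point \<open>x\<close> of \<open>Q'\<close> gets its value from the section \<open>\<tau>\<close> based at the point
  \<open>\<zeta> x\<close> of \<open>Q\<close>. This is continuous because near \<open>x\<close> the base point can be frozen: for \<open>x'\<close> close to
  \<open>x\<close>, the sections based at \<open>\<zeta> x\<close> and at \<open>\<zeta> x'\<close> both agree with \<open>\<sigma>\<close> at \<open>\<zeta> x'\<close>, and the domains being
  convex, they agree at \<open>x'\<close> too.\<close>

lemma extend_section:
  assumes E: "Hausdorff_space E" "locally_injective E D"
    and sec: "section_over E D (Euclidean_space m) Q \<sigma>" and Q: "cvx Q"
    and Q': "openin (Euclidean_space m) Q'"
    and \<zeta>: "continuous_on Q' \<zeta>" "\<zeta> ` Q' \<subseteq> Q"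
    and loc: "\<And>z. z \<in> Q \<Longrightarrow> \<exists>P \<tau>. section_over E D (Euclidean_space m) P \<tau> \<and> cvx P \<and> z \<in> P \<and>
                \<tau> z = \<sigma> z \<and> (\<forall>x\<in>Q'. \<zeta> x = z \<longrightarrow> x \<in> P)"
    and y: "y \<in> Q'" "\<zeta> y = y"
  obtains \<tau> where "section_over E D (Euclidean_space m) Q' \<tau>" "\<tau> y = \<sigma> y"
proof -
  let ?X = "Euclidean_space m"
  define good where "good z P \<tau> \<longleftrightarrow> section_over E D ?X P \<tau> \<and> cvx P \<and> z \<in> P \<and> \<tau> z = \<sigma> z \<and>
      (\<forall>x\<in>Q'. \<zeta> x = z \<longrightarrow> x \<in> P)" for z P \<tau>
  have "\<forall>z\<in>Q. \<exists>P \<tau>. good z P \<tau>" using loc by (simp add: good_def)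
  then obtain P \<rho> where "\<forall>z\<in>Q. good z (P z) (\<rho> z)" by metis
  then have P: "\<And>z. z \<in> Q \<Longrightarrow> section_over E D ?X (P z) (\<rho> z)" "\<And>z. z \<in> Q \<Longrightarrow> cvx (P z)"
      "\<And>z. z \<in> Q \<Longrightarrow> z \<in> P z" "\<And>z. z \<in> Q \<Longrightarrow> \<rho> z z = \<sigma> z"
      "\<And>x. x \<in> Q' \<Longrightarrow> x \<in> P (\<zeta> x)"
    using \<zeta>(2) by (auto simp: good_def)
  have Pop: "openin ?X (P z)" if "z \<in> Q" for z
    using P(1)[OF that] by (simp add: section_over_def)
  have Qop: "openin ?X Q" using sec by (simp add: section_over_def)
  have Q't: "Q' \<subseteq> topspace ?X" using Q' openin_subset by blast
  have Qt: "Q \<subseteq> topspace ?X" using Qop openin_subset by blast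
  \<comment> \<open>the set on which the base point \<open>\<zeta> x\<close> can be replaced by the fixed point \<open>z\<close>\<close>
  define T where "T z = {x \<in> Q'. x \<in> P z \<and> \<zeta> x \<in> P z}" for z
  have \<zeta>c: "continuous_map (subtopology ?X Q') ?X \<zeta>"
    using \<zeta> Q't Qt by (subst cm_Euclidean_space_iff_continuous_on) (auto simp: Int_absorb1)
  have T: "openin ?X (T z)" if "z \<in> Q" for z
  proof -
    have "openin (subtopology ?X Q') {x \<in> topspace (subtopology ?X Q'). \<zeta> x \<in> P z}"
      by (rule openin_continuous_map_preimage[OF \<zeta>c Pop[OF that]])
    then have "openin ?X {x \<in> topspace (subtopology ?X Q'). \<zeta> x \<in> P z}"
      using Q' openin_trans_full by blast
    then have "openin ?X ({x \<in> topspace (subtopology ?X Q'). \<zeta> x \<in> P z} \<inter> P z)"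
      using Pop[OF that] by blast
    also have "{x \<in> topspace (subtopology ?X Q'). \<zeta> x \<in> P z} \<inter> P z = T z"
      using Q't by (auto simp: T_def)
    finally show ?thesis .
  qed
  have con: "connectedin ?X (A \<inter> B)" if "cvx A" "cvx B" "openin ?X A" for A B
    using that cvx_Int connectedin_cvx openin_subset by blast
  have key: "\<rho> z x = \<rho> (\<zeta> x) x" if "z \<in> Q" "x \<in> T z" for z x
  proof -
    have x: "x \<in> Q'" "x \<in> P z" "\<zeta> x \<in> P z" "\<zeta> x \<in> Q" using that \<zeta>(2) by (auto simp: T_def)
    have "\<rho> z (\<zeta> x) = \<sigma> (\<zeta> x)"
      by (rule sections_eq[OF E P(1)[OF that(1)] sec con[OF P(2)[OF that(1)] Q Pop[OF that(1)]]
            P(3)[OF that(1)] that(1) P(4)[OF that(1)] x(3,4)])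
    then have "\<rho> z (\<zeta> x) = \<rho> (\<zeta> x) (\<zeta> x)" using P(4) x by simp
    then show ?thesis
      by (rule sections_eq[OF E P(1)[OF that(1)] P(1)[OF x(4)] con[OF P(2)[OF that(1)] P(2)[OF x(4)]
            Pop[OF that(1)]] x(3) P(3)[OF x(4)] _ x(2) P(5)[OF x(1)]])
  qed
  obtain \<tau> where \<tau>: "section_over E D ?X (\<Union>z\<in>Q. T z) \<tau>"
      "\<And>z x. z \<in> Q \<Longrightarrow> x \<in> T z \<Longrightarrow> \<tau> x = \<rho> z x"
  proof (rule section_over_UN[where I=Q and E=E and D=D and X="?X" and C=T and \<sigma>=\<rho>])
    show "section_over E D ?X (T z) (\<rho> z)" if "z \<in> Q" for z
      by (rule section_over_subset[OF P(1)[OF that] T[OF that]]) (auto simp: T_def)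
    show "\<rho> i x = \<rho> j x" if "i \<in> Q" "j \<in> Q" "x \<in> T i" "x \<in> T j" for i j x
      using key that by metis
  qed (erule that, blast)
  have "(\<Union>z\<in>Q. T z) = Q'"
    using P(3,5) \<zeta>(2) by (fastforce simp: T_def)
  moreover have "\<tau> y = \<sigma> y"
  proof -
    have "y \<in> Q" using y \<zeta>(2) by force
    moreover have "y \<in> T y" using y P(5)[of y] by (simp add: T_def)
    ultimately show ?thesis using \<tau>(2) P(4) by metis
  qed
  ultimately show ?thesis using that \<tau>(1) by simp
qed

lemma section_over_image: "section_over E D X C \<sigma> \<Longrightarrow> C \<subseteq> D ` topspace E"
proof
  fix x assume sec: "section_over E D X C \<sigma>" and "x \<in> C"
  then have "\<sigma> x \<in> topspace E" "x = D (\<sigma> x)"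
    by (rule section_over_in_topspace) (use sec \<open>x \<in> C\<close> in \<open>simp add: section_over_def\<close>)
  then show "x \<in> D ` topspace E" by (rule rev_image_eqI)
qed

text \<open>Close to \<open>\<sigma> x\<close>, local injectivity of \<open>D\<close> forces \<open>w = \<sigma> (D w)\<close>, so a whole neighbourhood of
  \<open>\<sigma> x\<close> lies in the image.\<close>

lemma openin_section_image:
  assumes D: "continuous_map E X D" "locally_injective E D"
    and sec: "section_over E D X T \<sigma>"
  shows "openin E (\<sigma> ` T)"
proof (subst openin_subopen, intro ballI)
  have T: "openin X T" and c: "continuous_map (subtopology X T) E \<sigma>"
    and Ds: "\<And>x. x \<in> T \<Longrightarrow> D (\<sigma> x) = x"
    using sec by (auto simp: section_over_def)
  have top: "topspace (subtopology X T) = T" using openin_subset[OF T] by auto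
  fix v assume "v \<in> \<sigma> ` T"
  then obtain x where x: "x \<in> T" "v = \<sigma> x" by blast
  then have "v \<in> topspace E" using section_over_in_topspace[OF sec] by simp
  then obtain W where W: "openin E W" "v \<in> W" "inj_on D W"
    using D(2) by (auto simp: locally_injective_def)
  let ?O = "{z \<in> topspace (subtopology X T). \<sigma> z \<in> W}"
  have "openin (subtopology X T) ?O"
    by (rule openin_continuous_map_preimage[OF c W(1)])
  then have "openin X ?O" using T openin_trans_full by blast
  then have "openin E {w \<in> topspace E. D w \<in> ?O}"
    by (rule openin_continuous_map_preimage[OF D(1)])
  then have "openin E ({w \<in> topspace E. D w \<in> ?O} \<inter> W)"
    using W(1) by blast
  moreover have "v \<in> {w \<in> topspace E. D w \<in> ?O} \<inter> W"
    using x W(2) \<open>v \<in> topspace E\<close> by (simp only: top) (simp add: Ds)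
  moreover have "{w \<in> topspace E. D w \<in> ?O} \<inter> W \<subseteq> \<sigma> ` T"
  proof
    fix w assume w: "w \<in> {w \<in> topspace E. D w \<in> ?O} \<inter> W"
    then have "D w \<in> T" "\<sigma> (D w) \<in> W" "w \<in> W" by (auto simp: top)
    then have "\<sigma> (D w) = w" using Ds by (intro inj_onD[OF W(3)]) simp_all
    then show "w \<in> \<sigma> ` T" using \<open>D w \<in> T\<close> by (metis imageI)
  qed
  ultimately show "\<exists>S. openin E S \<and> v \<in> S \<and> S \<subseteq> \<sigma> ` T" by blast
qed

text \<open>The sheets over \<open>T\<close> are the images of the sections over \<open>T\<close>. They exhaust the preimage of \<open>T\<close>, and
  two of them that meet are equal because \<open>T\<close> is connected.\<close>

lemma covering_map_if_sections:
  assumes E: "Hausdorff_space E" and D: "continuous_map E X D" "locally_injective E D"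
    and surj: "D ` topspace E = topspace X"
    and sec: "\<And>b. b \<in> topspace X \<Longrightarrow> \<exists>T. b \<in> T \<and> openin X T \<and> connectedin X T \<and>
       (\<forall>u\<in>topspace E. D u \<in> T \<longrightarrow> (\<exists>\<sigma>. section_over E D X T \<sigma> \<and> \<sigma> (D u) = u))"
  shows "covering_map E D X"
  unfolding covering_map_def
proof (intro conjI ballI)
  show "continuous_map E X D" "D ` topspace E = topspace X" using D surj by auto
  fix b assume "b \<in> topspace X"
  then obtain T where T: "b \<in> T" "openin X T" "connectedin X T"
      and ex: "\<And>u. u \<in> topspace E \<Longrightarrow> D u \<in> T \<Longrightarrow> \<exists>\<sigma>. section_over E D X T \<sigma> \<and> \<sigma> (D u) = u"
    using sec by meson
  let ?V = "{\<sigma> ` T | \<sigma>. section_over E D X T \<sigma>}"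
  have top: "topspace (subtopology X T) = T" using openin_subset[OF T(2)] by auto
  have "\<Union>?V = {x \<in> topspace E. D x \<in> T}"
  proof (intro equalityI subsetI)
    fix x assume "x \<in> \<Union>?V"
    then obtain \<sigma> y where \<sigma>: "section_over E D X T \<sigma>" "y \<in> T" "x = \<sigma> y" by blast
    then have "D x = y" by (simp add: section_over_def)
    then show "x \<in> {x \<in> topspace E. D x \<in> T}"
      using section_over_in_topspace[OF \<sigma>(1,2)] \<sigma> by simp
  next
    fix x assume x: "x \<in> {x \<in> topspace E. D x \<in> T}"
    then obtain \<sigma> where "section_over E D X T \<sigma>" "\<sigma> (D x) = x" using ex by blast
    moreover have "D x \<in> T" using x by simp
    ultimately have "x \<in> \<sigma> ` T" "section_over E D X T \<sigma>" by (metis imageI, simp)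
    then show "x \<in> \<Union>?V" by blast
  qed
  moreover have "\<forall>V\<in>?V. openin E V"
    using openin_section_image[OF D] by blast
  moreover have "pairwise disjnt ?V"
  proof (rule pairwiseI)
    fix V V' assume "V \<in> ?V" "V' \<in> ?V" "V \<noteq> V'"
    then obtain \<sigma> \<tau> where s: "section_over E D X T \<sigma>" "V = \<sigma> ` T"
        "section_over E D X T \<tau>" "V' = \<tau> ` T" by blast
    show "disjnt V V'"
    proof (rule ccontr)
      assume "\<not> disjnt V V'"
      then obtain x y where xy: "x \<in> T" "y \<in> T" "\<sigma> x = \<tau> y" using s by (auto simp: disjnt_def)
      then have "x = y" using s unfolding section_over_def by metis
      have con: "connectedin X (T \<inter> T)" using T(3) by simp
      have "\<sigma> z = \<tau> z" if "z \<in> T" for z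
        by (rule sections_eq[OF E D(2) s(1,3) con xy(1) xy(1) _ that that]) (use xy \<open>x = y\<close> in simp)
      then have "V = V'" using s by simp
      with \<open>V \<noteq> V'\<close> show False by simp
    qed
  qed
  moreover have "\<forall>V\<in>?V. homeomorphic_map (subtopology E V) (subtopology X T) D"
  proof
    fix V assume "V \<in> ?V"
    then obtain \<sigma> where s: "section_over E D X T \<sigma>" "V = \<sigma> ` T" by blast
    have "V \<subseteq> topspace E" using s(2) section_over_in_topspace[OF s(1)] by blast
    then have topV: "topspace (subtopology E V) = V" by auto
    have "continuous_map (subtopology E V) (subtopology X T) D"
      unfolding continuous_map_in_subtopology topV
      using continuous_map_from_subtopology[OF D(1), of V] s by (simp add: section_over_def Pi_iff)
    moreover have "continuous_map (subtopology X T) (subtopology E V) \<sigma>"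
      using s unfolding continuous_map_in_subtopology top by (simp add: section_over_def)
    ultimately have "homeomorphic_maps (subtopology E V) (subtopology X T) D \<sigma>"
      using s topV top by (auto simp: homeomorphic_maps_def section_over_def)
    then show "homeomorphic_map (subtopology E V) (subtopology X T) D"
      using homeomorphic_map_maps by blast
  qed
  ultimately show "\<exists>T. b \<in> T \<and> openin X T \<and> (\<exists>\<V>. \<Union>\<V> = {x \<in> topspace E. D x \<in> T} \<and>
      (\<forall>V\<in>\<V>. openin E V) \<and> pairwise disjnt \<V> \<and>
      (\<forall>V\<in>\<V>. homeomorphic_map (subtopology E V) (subtopology X T) D))"
    using T(1,2) by (intro exI[of _ T] exI[of _ ?V] conjI)
qed

section \<open>Sheared cylinders\<close>

text \<open>What an element of the group makes of a round cylinder with axis in the last direction: the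
  horizontal discs stay round, of radius \<open>r\<close>, since \<open>O(n)\<close> acts on them, the height \<open>e\<close> stays the same,
  but the centres of the discs drift with slope \<open>\<beta>\<close> when the last coordinate varies. The slope takes
  arbitrary values, so a uniform \<open>r\<close> and \<open>e\<close> do not give balls of a uniform radius.\<close>

definition scyl :: "nat \<Rightarrow> (nat \<Rightarrow> real) \<Rightarrow> (nat \<Rightarrow> real) \<Rightarrow> real \<Rightarrow> real \<Rightarrow> (nat \<Rightarrow> real) set" where
  "scyl n y \<beta> r e = {x \<in> topspace (Euclidean_space (Suc n)). \<bar>x n - y n\<bar> < e \<and>
     L2_set (\<lambda>i. x i - y i - \<beta> i * (x n - y n)) {..<n} < r}"

lemma scyl_subset: "scyl n y \<beta> r e \<subseteq> topspace (Euclidean_space (Suc n))"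
  by (auto simp: scyl_def)

lemma seg_in_topspace:
  "x \<in> topspace (Euclidean_space m) \<Longrightarrow> y \<in> topspace (Euclidean_space m) \<Longrightarrow>
    seg t x y \<in> topspace (Euclidean_space m)"
  by (auto simp: topspace_Euclidean_space seg_def)

lemma convex_abs_less:
  fixes a b :: real
  assumes "\<bar>a\<bar> < e" "\<bar>b\<bar> < e" "t \<in> {0..1}"
  shows "\<bar>(1 - t) * a + t * b\<bar> < e"
proof -
  have "\<bar>(1 - t) * a + t * b\<bar> \<le> (1 - t) * \<bar>a\<bar> + t * \<bar>b\<bar>"
    using assms(3) abs_triangle_ineq[of "(1 - t) * a" "t * b"] by (simp add: abs_mult)
  also have "\<dots> < e" using assms by (intro convex_bound_lt) auto
  finally show ?thesis .
qed

lemma cvx_slab: "cvx {x \<in> topspace (Euclidean_space (Suc n)). \<bar>x n - s\<bar> < e}"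
  unfolding cvx_def
proof (intro ballI)
  fix x y t assume x: "x \<in> {x \<in> topspace (Euclidean_space (Suc n)). \<bar>x n - s\<bar> < e}"
    and y: "y \<in> {x \<in> topspace (Euclidean_space (Suc n)). \<bar>x n - s\<bar> < e}" and t: "t \<in> {0..1::real}"
  have "seg t x y n - s = (1 - t) * (x n - s) + t * (y n - s)"
    by (simp add: seg_def algebra_simps)
  then show "seg t x y \<in> {x \<in> topspace (Euclidean_space (Suc n)). \<bar>x n - s\<bar> < e}"
    using convex_abs_less[of "x n - s" e "y n - s" t] x y t seg_in_topspace by auto
qed

lemma cvx_scyl: "cvx (scyl n c \<beta> r e)"
  unfolding cvx_def
proof (intro ballI)
  fix x y t assume x: "x \<in> scyl n c \<beta> r e" and y: "y \<in> scyl n c \<beta> r e" and t: "t \<in> {0..1::real}"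
  let ?f = "\<lambda>x i. x i - c i - \<beta> i * (x n - c n)"
  have "?f (seg t x y) i = (1 - t) * ?f x i + t * ?f y i" for i
    by (simp add: seg_def algebra_simps)
  then have "L2_set (?f (seg t x y)) {..<n} = L2_set (\<lambda>i. (1 - t) * ?f x i + t * ?f y i) {..<n}"
    by presburger
  also have "\<dots> \<le> L2_set (\<lambda>i. (1 - t) * ?f x i) {..<n} + L2_set (\<lambda>i. t * ?f y i) {..<n}"
    by (rule L2_set_triangle_ineq)
  also have "\<dots> = (1 - t) * L2_set (?f x) {..<n} + t * L2_set (?f y) {..<n}"
    using t by (simp add: L2_set_right_distrib)
  also have "\<dots> < r"
    using x y t by (intro convex_bound_lt) (auto simp: scyl_def)
  finally have "L2_set (?f (seg t x y)) {..<n} < r" .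
  moreover have "seg t x y \<in> {x \<in> topspace (Euclidean_space (Suc n)). \<bar>x n - c n\<bar> < e}"
    using cvx_slab[of n "c n" e] x y t unfolding cvx_def by (auto simp: scyl_def)
  ultimately show "seg t x y \<in> scyl n c \<beta> r e"
    by (auto simp: scyl_def)
qed

lemma openin_slab:
  "openin (Euclidean_space (Suc n)) {x \<in> topspace (Euclidean_space (Suc n)). \<bar>x n - s\<bar> < e}"
proof -
  have "open {x :: nat \<Rightarrow> real. \<bar>x n - s\<bar> < e}"
    by (intro open_Collect_less continuous_intros continuous_on_product_coordinates)
  from openin_Euclidean_space_Int_open[OF this] show ?thesis
    by (simp add: Collect_conj_eq)
qed

lemma openin_scyl: "openin (Euclidean_space (Suc n)) (scyl n y \<beta> r e)"
proof -
  have "open ({x :: nat \<Rightarrow> real. \<bar>x n - y n\<bar> < e} \<inter>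
      {x. L2_set (\<lambda>i. x i - y i - \<beta> i * (x n - y n)) {..<n} < r})"
    unfolding L2_set_def
    by (intro open_Int open_Collect_less continuous_intros continuous_on_product_coordinates)
  from openin_Euclidean_space_Int_open[OF this] show ?thesis
    by (rule back_subst[of "openin (Euclidean_space (Suc n))"]) (auto simp: scyl_def)
qed

lemma center_in_scyl:
  "y \<in> topspace (Euclidean_space (Suc n)) \<Longrightarrow> 0 < r \<Longrightarrow> 0 < e \<Longrightarrow> y \<in> scyl n y \<beta> r e"
  by (simp add: scyl_def L2_set_def)

section \<open>Horizontal extension of sections\<close>

text \<open>Shrinking the horizontal discs about their centres by the factor \<open>r / r'\<close> moves the points by less
  than \<open>\<epsilon>\<close>, and inside their level. The section based at the shrunk point therefore reaches the
  original one, whatever its slope, because the slope displaces only other levels. For this reason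
  the height of the cylinder is not reduced.\<close>

lemma widen_section:
  assumes E: "Hausdorff_space E" "locally_injective E D" and "0 < \<epsilon>"
    and loc: "\<And>u. u \<in> topspace E \<Longrightarrow>
       \<exists>\<beta> \<tau>. section_over E D (Euclidean_space (Suc n)) (scyl n (D u) \<beta> \<epsilon> \<epsilon>) \<tau> \<and> \<tau> (D u) = u"
    and sec: "section_over E D (Euclidean_space (Suc n)) (scyl n y \<beta> r \<epsilon>) \<sigma>"
    and r: "0 < r" "r < r'" "r' < r + \<epsilon>" and y: "y \<in> topspace (Euclidean_space (Suc n))"
  obtains \<tau> where "section_over E D (Euclidean_space (Suc n)) (scyl n y \<beta> r' \<epsilon>) \<tau>" "\<tau> y = \<sigma> y"
proof -
  define f where "f x i = x i - y i - \<beta> i * (x n - y n)" for x :: "nat \<Rightarrow> real" and i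
  define \<mu> where "\<mu> = r / r'"
  have \<mu>: "0 < \<mu>" "\<mu> < 1" using r by (auto simp: \<mu>_def)
  define \<zeta> where "\<zeta> x i = (if i < n then x i - (1 - \<mu>) * f x i else x i)"
    for x :: "nat \<Rightarrow> real" and i
  have f\<zeta>: "f (\<zeta> x) i = \<mu> * f x i" if "i < n" for x i
    using that by (simp add: \<zeta>_def f_def algebra_simps)
  have mem: "x \<in> scyl n y \<beta> s \<epsilon> \<longleftrightarrow>
      x \<in> topspace (Euclidean_space (Suc n)) \<and> \<bar>x n - y n\<bar> < \<epsilon> \<and> L2_set (f x) {..<n} < s" for x s
    by (simp add: scyl_def f_def[abs_def])
  show ?thesis
  proof (rule extend_section[OF E sec cvx_scyl openin_scyl[of n y \<beta> r' \<epsilon>], where \<zeta>=\<zeta> and y=y])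
    show "continuous_on (scyl n y \<beta> r' \<epsilon>) \<zeta>"
    proof (rule continuous_on_coordinatewise_then_product)
      fix i
      show "continuous_on (scyl n y \<beta> r' \<epsilon>) (\<lambda>x. \<zeta> x i)"
        by (cases "i < n")
          (auto simp: \<zeta>_def f_def intro!: continuous_intros
             continuous_on_subset[OF continuous_on_product_coordinates])
    qed
    show "\<zeta> ` scyl n y \<beta> r' \<epsilon> \<subseteq> scyl n y \<beta> r \<epsilon>"
    proof clarify
      fix x assume x: "x \<in> scyl n y \<beta> r' \<epsilon>"
      have "L2_set (f (\<zeta> x)) {..<n} = L2_set (\<lambda>i. \<mu> * f x i) {..<n}"
        by (rule L2_set_cong) (auto simp: f\<zeta>)
      also have "\<dots> = \<mu> * L2_set (f x) {..<n}"
        using \<mu> by (simp add: L2_set_right_distrib)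
      also have "\<dots> < \<mu> * r'"
        using x \<mu> by (simp add: mem)
      also have "\<dots> = r" using r by (simp add: \<mu>_def)
      finally show "\<zeta> x \<in> scyl n y \<beta> r \<epsilon>"
        using x by (auto simp: mem topspace_Euclidean_space \<zeta>_def)
    qed
    show "y \<in> scyl n y \<beta> r' \<epsilon>"
      using y r \<open>0 < \<epsilon>\<close> by (intro center_in_scyl) auto
    show "\<zeta> y = y" by (auto simp: \<zeta>_def f_def)
    fix z assume z: "z \<in> scyl n y \<beta> r \<epsilon>"
    then have Dz: "D (\<sigma> z) = z" "\<sigma> z \<in> topspace E"
      using sec section_over_in_topspace[OF sec] by (auto simp: section_over_def)
    then obtain \<gamma> \<tau> where \<tau>:
        "section_over E D (Euclidean_space (Suc n)) (scyl n z \<gamma> \<epsilon> \<epsilon>) \<tau>" "\<tau> z = \<sigma> z"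
      using loc[OF Dz(2)] by auto
    have "x \<in> scyl n z \<gamma> \<epsilon> \<epsilon>" if x: "x \<in> scyl n y \<beta> r' \<epsilon>" and "\<zeta> x = z" for x
    proof -
      have "x n = z n" using that by (auto simp: \<zeta>_def)
      have "L2_set (\<lambda>i. x i - z i - \<gamma> i * (x n - z n)) {..<n} = L2_set (\<lambda>i. (1 - \<mu>) * f x i) {..<n}"
        using \<open>x n = z n\<close> \<open>\<zeta> x = z\<close> by (intro L2_set_cong) (auto simp: \<zeta>_def)
      also have "\<dots> = (1 - \<mu>) * L2_set (f x) {..<n}"
        using \<mu> by (simp add: L2_set_right_distrib)
      also have "\<dots> < (1 - \<mu>) * r'"
        using x \<mu> by (simp add: mem)
      also have "\<dots> = r' - r" using r by (simp add: \<mu>_def field_simps)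
      also have "\<dots> < \<epsilon>" using r by simp
      finally show ?thesis
        using x \<open>x n = z n\<close> \<open>0 < \<epsilon>\<close> by (auto simp: scyl_def)
    qed
    moreover have "z \<in> scyl n z \<gamma> \<epsilon> \<epsilon>"
      using subsetD[OF scyl_subset z] \<open>0 < \<epsilon>\<close> by (intro center_in_scyl)
    ultimately show "\<exists>P \<tau>. section_over E D (Euclidean_space (Suc n)) P \<tau> \<and> cvx P \<and> z \<in> P \<and>
        \<tau> z = \<sigma> z \<and> (\<forall>x\<in>scyl n y \<beta> r' \<epsilon>. \<zeta> x = z \<longrightarrow> x \<in> P)"
      using \<tau> cvx_scyl by blast
  qed (rule that)
qed

text \<open>Widening by \<open>\<epsilon> / 2\<close> can be iterated without end, and the cylinders so obtained fill the slab.\<close>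

lemma slab_section:
  assumes E: "Hausdorff_space E" "locally_injective E D" and "0 < \<epsilon>"
    and D: "D \<in> topspace E \<rightarrow> topspace (Euclidean_space (Suc n))"
    and loc: "\<And>u. u \<in> topspace E \<Longrightarrow>
       \<exists>\<beta> \<tau>. section_over E D (Euclidean_space (Suc n)) (scyl n (D u) \<beta> \<epsilon> \<epsilon>) \<tau> \<and> \<tau> (D u) = u"
    and u: "u \<in> topspace E"
  obtains \<sigma> where "section_over E D (Euclidean_space (Suc n))
      {x \<in> topspace (Euclidean_space (Suc n)). \<bar>x n - D u n\<bar> < \<epsilon>} \<sigma>" "\<sigma> (D u) = u"
proof -
  let ?X = "Euclidean_space (Suc n)"
  have y: "D u \<in> topspace ?X" using D u by auto
  obtain \<beta> \<tau>0 where \<tau>0: "section_over E D ?X (scyl n (D u) \<beta> \<epsilon> \<epsilon>) \<tau>0" "\<tau>0 (D u) = u"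
    using loc[OF u] by blast
  define r where "r j = \<epsilon> + real j * (\<epsilon> / 2)" for j :: nat
  have r: "0 < r j" "r j < r (Suc j)" "r (Suc j) < r j + \<epsilon>" for j
    using \<open>0 < \<epsilon>\<close> by (simp_all add: r_def add_pos_nonneg distrib_right)
  have "\<exists>\<tau>. section_over E D ?X (scyl n (D u) \<beta> (r j) \<epsilon>) \<tau> \<and> \<tau> (D u) = u" for j
  proof (induction j)
    case 0
    then show ?case using \<tau>0 by (auto simp: r_def)
  next
    case (Suc j)
    then obtain \<tau> where "section_over E D ?X (scyl n (D u) \<beta> (r j) \<epsilon>) \<tau>" "\<tau> (D u) = u" by blast
    then show ?case
      using widen_section[OF E \<open>0 < \<epsilon>\<close> loc _ r y] by metis
  qed
  then obtain \<tau> where \<tau>: "\<And>j. section_over E D ?X (scyl n (D u) \<beta> (r j) \<epsilon>) (\<tau> j)"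
      "\<And>j. \<tau> j (D u) = u" by metis
  have cen: "D u \<in> scyl n (D u) \<beta> (r j) \<epsilon>" for j
    using y r \<open>0 < \<epsilon>\<close> by (intro center_in_scyl)
  have con: "connectedin ?X (scyl n (D u) \<beta> (r i) \<epsilon> \<inter> scyl n (D u) \<beta> (r j) \<epsilon>)" for i j
    using scyl_subset by (intro connectedin_cvx cvx_Int cvx_scyl) blast
  obtain \<sigma> where \<sigma>: "section_over E D ?X (\<Union>j\<in>UNIV. scyl n (D u) \<beta> (r j) \<epsilon>) \<sigma>"
      "\<And>j x. j \<in> UNIV \<Longrightarrow> x \<in> scyl n (D u) \<beta> (r j) \<epsilon> \<Longrightarrow> \<sigma> x = \<tau> j x"
  proof (rule section_over_UN[where I=UNIV and E=E and D=D and X="?X" and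
        C="\<lambda>j. scyl n (D u) \<beta> (r j) \<epsilon>" and \<sigma>=\<tau>])
    show "\<tau> i x = \<tau> j x" if "x \<in> scyl n (D u) \<beta> (r i) \<epsilon>" "x \<in> scyl n (D u) \<beta> (r j) \<epsilon>" for i j x
      by (rule sections_eq[OF E \<tau>(1) \<tau>(1) con cen cen _ that]) (simp add: \<tau>(2))
  qed (rule \<tau>(1), erule that, blast)
  moreover have "(\<Union>j\<in>UNIV. scyl n (D u) \<beta> (r j) \<epsilon>) = {x \<in> topspace ?X. \<bar>x n - D u n\<bar> < \<epsilon>}"
  proof (intro equalityI subsetI)
    fix x assume x: "x \<in> {x \<in> topspace ?X. \<bar>x n - D u n\<bar> < \<epsilon>}"
    let ?s = "L2_set (\<lambda>i. x i - D u i - \<beta> i * (x n - D u n)) {..<n}"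
    obtain j :: nat where "?s / (\<epsilon> / 2) < real j" using reals_Archimedean2 by blast
    then have "?s < r j" using \<open>0 < \<epsilon>\<close> by (simp add: r_def field_simps)
    then show "x \<in> (\<Union>j\<in>UNIV. scyl n (D u) \<beta> (r j) \<epsilon>)" using x by (auto simp: scyl_def)
  qed (auto simp: scyl_def)
  moreover have "\<sigma> (D u) = u" using \<sigma>(2)[OF _ cen[of 0]] \<tau>(2) by simp
  ultimately show ?thesis using that by metis
qed

text \<open>A slab of half-height \<open>\<epsilon> / 2\<close> is contained in the slab of half-height \<open>\<epsilon>\<close> around the level of any
  of its points, hence it is evenly covered by \<open>slab_section\<close>. All levels are attained since one
  can climb from one to another by steps shorter than \<open>\<epsilon> / 2\<close>.\<close>

lemma covering_map_if_scyl_sections: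
  assumes E: "Hausdorff_space E" "topspace E \<noteq> {}"
    and D: "continuous_map E (Euclidean_space (Suc n)) D" "locally_injective E D" and "0 < \<epsilon>"
    and loc: "\<And>u. u \<in> topspace E \<Longrightarrow>
       \<exists>\<beta> \<tau>. section_over E D (Euclidean_space (Suc n)) (scyl n (D u) \<beta> \<epsilon> \<epsilon>) \<tau> \<and> \<tau> (D u) = u"
  shows "covering_map E D (Euclidean_space (Suc n))"
proof -
  let ?X = "Euclidean_space (Suc n)"
  have Dt: "D \<in> topspace E \<rightarrow> topspace ?X" using D(1) by (simp add: continuous_map_def)
  have slab: "\<exists>\<sigma>. section_over E D ?X {x \<in> topspace ?X. \<bar>x n - D u n\<bar> < \<epsilon>} \<sigma> \<and> \<sigma> (D u) = u"
    if u: "u \<in> topspace E" for u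
    by (rule slab_section[OF E(1) D(2) \<open>0 < \<epsilon>\<close> Dt loc u]) auto
  show ?thesis
  proof (rule covering_map_if_sections[OF E(1) D])
    obtain u0 where u0: "u0 \<in> topspace E" using E(2) by (meson ex_in_conv)
    have "x \<in> D ` topspace E" if "x \<in> topspace ?X" "\<bar>x n - D u0 n\<bar> < real (Suc j) * (\<epsilon> / 2)" for j x
      using that
    proof (induction j arbitrary: x)
      case 0
      obtain \<sigma> where \<sigma>: "section_over E D ?X {x \<in> topspace ?X. \<bar>x n - D u0 n\<bar> < \<epsilon>} \<sigma>"
        using slab[OF u0] by blast
      have "x \<in> {x \<in> topspace ?X. \<bar>x n - D u0 n\<bar> < \<epsilon>}" using 0 \<open>0 < \<epsilon>\<close> by auto
      then show ?case
        using section_over_image[OF \<sigma>] by blast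
    next
      case (Suc j)
      define d where "d = x n - D u0 n"
      \<comment> \<open>the last of \<open>Suc (Suc j)\<close> equal steps from the level of \<open>D u0\<close> to that of \<open>x\<close>\<close>
      define s where "s = D u0 n + d * (real (Suc j) / real (Suc (Suc j)))"
      define z where "z = x(n := s)"
      have dlt: "\<bar>d\<bar> < real (Suc (Suc j)) * (\<epsilon> / 2)" using Suc.prems by (simp add: d_def)
      define N where "N = real (Suc (Suc j))"
      have N: "0 < N" "real (Suc j) = N - 1" "0 < N - 1" by (auto simp: N_def)
      have dN: "\<bar>d\<bar> / N < \<epsilon> / 2" using dlt N by (simp add: N_def[symmetric] pos_divide_less_eq mult.commute)
      have "x n - s = d / N"
        using N unfolding s_def N(2) N_def[symmetric] by (simp add: d_def field_simps)
      then have xs: "\<bar>x n - s\<bar> < \<epsilon> / 2" using dN N by (simp add: abs_divide)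
      have "\<bar>s - D u0 n\<bar> = (\<bar>d\<bar> / N) * (N - 1)"
        using N unfolding s_def N(2) N_def[symmetric] by (simp add: abs_mult abs_divide)
      also have "\<dots> < \<epsilon> / 2 * (N - 1)"
        using dN N by (intro mult_strict_right_mono) auto
      also have "\<dots> = real (Suc j) * (\<epsilon> / 2)" using N by simp
      finally have "z \<in> D ` topspace E"
        using Suc.prems(1) by (intro Suc.IH) (simp_all add: z_def topspace_Euclidean_space)
      then obtain v where v: "v \<in> topspace E" "D v = z" by blast
      obtain \<sigma> where \<sigma>: "section_over E D ?X {x \<in> topspace ?X. \<bar>x n - D v n\<bar> < \<epsilon>} \<sigma>"
        using slab[OF v(1)] by blast
      have "x \<in> {x \<in> topspace ?X. \<bar>x n - D v n\<bar> < \<epsilon>}"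
        using Suc.prems(1) v xs \<open>0 < \<epsilon>\<close> by (simp add: z_def)
      then show ?case
        using section_over_image[OF \<sigma>] by blast
    qed
    moreover have "\<exists>j::nat. \<bar>x n - D u0 n\<bar> < real (Suc j) * (\<epsilon> / 2)" for x
    proof -
      obtain j :: nat where "\<bar>x n - D u0 n\<bar> / (\<epsilon> / 2) < real j" using reals_Archimedean2 by blast
      then have "\<bar>x n - D u0 n\<bar> < real (Suc j) * (\<epsilon> / 2)" using \<open>0 < \<epsilon>\<close> by (simp add: field_simps)
      then show ?thesis by blast
    qed
    ultimately show "D ` topspace E = topspace ?X" using Dt by blast
    fix b assume b: "b \<in> topspace ?X"
    define T where "T = {x \<in> topspace ?X. \<bar>x n - b n\<bar> < \<epsilon> / 2}"
    have op: "openin ?X T" unfolding T_def by (rule openin_slab)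
    have con: "connectedin ?X T"
      unfolding T_def by (rule connectedin_cvx[OF cvx_slab]) (rule Collect_restrict)
    have bT: "b \<in> T" using b \<open>0 < \<epsilon>\<close> by (simp add: T_def)
    have "\<exists>\<sigma>. section_over E D ?X T \<sigma> \<and> \<sigma> (D u) = u" if u: "u \<in> topspace E" "D u \<in> T" for u
    proof -
      obtain \<sigma> where \<sigma>: "section_over E D ?X {x \<in> topspace ?X. \<bar>x n - D u n\<bar> < \<epsilon>} \<sigma>" "\<sigma> (D u) = u"
        using slab[OF u(1)] by blast
      have "\<bar>D u n - b n\<bar> < \<epsilon> / 2" using u(2) unfolding T_def by blast
      then have "T \<subseteq> {x \<in> topspace ?X. \<bar>x n - D u n\<bar> < \<epsilon>}"
        unfolding T_def by (intro Collect_mono impI conjI; elim conjE) (assumption, linarith)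
      from section_over_subset[OF \<sigma>(1) op this] \<sigma>(2) show ?thesis by (intro exI conjI)
    qed
    then have all: "\<forall>u\<in>topspace E. D u \<in> T \<longrightarrow> (\<exists>\<sigma>. section_over E D ?X T \<sigma> \<and> \<sigma> (D u) = u)"
      by blast
    show "\<exists>T. b \<in> T \<and> openin ?X T \<and> connectedin ?X T \<and>
       (\<forall>u\<in>topspace E. D u \<in> T \<longrightarrow> (\<exists>\<sigma>. section_over E D ?X T \<sigma> \<and> \<sigma> (D u) = u))"
      by (rule exI[of _ T], intro conjI bT op con all)
  qed
qed

section \<open>Boxes and compactness\<close>

definition obox :: "nat \<Rightarrow> (nat \<Rightarrow> real) \<Rightarrow> real \<Rightarrow> (nat \<Rightarrow> real) set" where
  "obox m y r = {x \<in> topspace (Euclidean_space m). \<forall>i<m. \<bar>x i - y i\<bar> < r}"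

definition closed_box :: "nat \<Rightarrow> (nat \<Rightarrow> real) \<Rightarrow> real \<Rightarrow> (nat \<Rightarrow> real) set" where
  "closed_box m y r = {x \<in> topspace (Euclidean_space m). \<forall>i<m. \<bar>x i - y i\<bar> \<le> r}"

lemma obox_subset: "obox m y r \<subseteq> topspace (Euclidean_space m)"
  by (auto simp: obox_def)

lemma center_in_obox: "y \<in> topspace (Euclidean_space m) \<Longrightarrow> 0 < r \<Longrightarrow> y \<in> obox m y r"
  by (simp add: obox_def)

lemma obox_mono: "r \<le> s \<Longrightarrow> obox m y r \<subseteq> obox m y s"
  unfolding obox_def by (intro Collect_mono) (meson less_le_trans)

lemma openin_obox: "openin (Euclidean_space m) (obox m y r)"
proof -
  have "open (\<Inter>i\<in>{..<m}. {x :: nat \<Rightarrow> real. \<bar>x i - y i\<bar> < r})"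
    by (intro open_INT ballI open_Collect_less continuous_intros continuous_on_product_coordinates) simp
  from openin_Euclidean_space_Int_open[OF this] show ?thesis
    by (rule back_subst[of "openin (Euclidean_space m)"]) (auto simp: obox_def)
qed

lemma cvx_obox: "cvx (obox m c r)"
  unfolding cvx_def
proof (intro ballI)
  fix x y t assume x: "x \<in> obox m c r" and y: "y \<in> obox m c r" and t: "t \<in> {0..1::real}"
  have "\<bar>seg t x y i - c i\<bar> < r" if "i < m" for i
  proof -
    have "seg t x y i - c i = (1 - t) * (x i - c i) + t * (y i - c i)"
      by (simp add: seg_def algebra_simps)
    then show ?thesis
      using convex_abs_less[of "x i - c i" r "y i - c i" t] x y t that by (simp add: obox_def)
  qed
  moreover have "seg t x y \<in> topspace (Euclidean_space m)"
    using x y seg_in_topspace by (simp add: obox_def)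
  ultimately show "seg t x y \<in> obox m c r" by (simp add: obox_def)
qed

text \<open>A basic open set constrains each coordinate separately; from \<open>m\<close> on the coordinates of all points
  are \<open>0\<close>, so finitely many radii remain.\<close>

lemma openin_contains_obox:
  assumes "openin (Euclidean_space m) T" "b \<in> T"
  obtains \<delta> where "0 < \<delta>" "obox m b \<delta> \<subseteq> T"
proof -
  obtain S where S: "openin (powertop_real UNIV) S" "T = S \<inter> {x. \<forall>i\<ge>m. x i = 0}"
    using assms(1) unfolding Euclidean_space_def openin_subtopology by blast
  then have "b \<in> S" using assms(2) by blast
  then obtain X where X: "b \<in> (\<Pi>\<^sub>E i\<in>UNIV. X i)" "\<And>i. open (X i)" "(\<Pi>\<^sub>E i\<in>UNIV. X i) \<subseteq> S"
    using product_topology_open_contains_basis[OF S(1)] by (metis open_openin)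
  have "\<exists>d>0. \<forall>s. \<bar>s - b i\<bar> < d \<longrightarrow> s \<in> X i" for i
  proof -
    have "b i \<in> X i" using X(1) by (simp add: PiE_iff)
    then obtain d where "0 < d" "\<forall>s. dist s (b i) < d \<longrightarrow> s \<in> X i"
      using X(2) open_dist by metis
    then show ?thesis by (auto simp: dist_real_def)
  qed
  then obtain d where d: "\<And>i. 0 < d i" "\<And>i s. \<bar>s - b i\<bar> < d i \<Longrightarrow> s \<in> X i" by metis
  define \<delta> where "\<delta> = Min (insert 1 (d ` {..<m}))"
  have "0 < \<delta>" using d(1) by (simp add: \<delta>_def)
  moreover have "\<delta> \<le> d i" if "i < m" for i using that by (simp add: \<delta>_def)
  have "obox m b \<delta> \<subseteq> T"
  proof
    fix x assume x: "x \<in> obox m b \<delta>"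
    have "x i \<in> X i" for i
    proof (cases "i < m")
      case True
      then have "\<bar>x i - b i\<bar> < d i" using x \<open>\<And>i. i < m \<Longrightarrow> \<delta> \<le> d i\<close>[OF True] by (auto simp: obox_def)
      then show ?thesis by (rule d(2))
    next
      case False
      then have "x i = 0" "b i = 0"
        using x assms(2) S(2) by (auto simp: obox_def topspace_Euclidean_space)
      then show ?thesis using X(1) by (metis PiE_E UNIV_I)
    qed
    then have "x \<in> S" using X(3) by (auto simp: PiE_iff)
    then show "x \<in> T" using x S(2) by (simp add: obox_def topspace_Euclidean_space)
  qed
  ultimately show ?thesis by (intro that)
qed

lemma compactin_closed_box:
  assumes "y \<in> topspace (Euclidean_space m)"
  shows "compactin (Euclidean_space m) (closed_box m y r)"
proof -
  let ?S = "\<lambda>i. if i < m then {y i - r..y i + r} else {0}"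
  have eq: "closed_box m y r = (\<Pi>\<^sub>E i\<in>UNIV. ?S i)"
  proof (intro equalityI subsetI)
    fix x assume "x \<in> closed_box m y r"
    then show "x \<in> (\<Pi>\<^sub>E i\<in>UNIV. ?S i)"
      by (auto simp: closed_box_def topspace_Euclidean_space PiE_iff abs_le_iff)
  next
    fix x assume x: "x \<in> (\<Pi>\<^sub>E i\<in>UNIV. ?S i)"
    then have *: "x i \<in> ?S i" for i by (simp add: PiE_iff)
    have "\<bar>x i - y i\<bar> \<le> r" if "i < m" for i using *[of i] that by (simp add: abs_le_iff)
    moreover have "x i = 0" if "m \<le> i" for i using *[of i] that by simp
    ultimately show "x \<in> closed_box m y r" by (simp add: closed_box_def topspace_Euclidean_space)
  qed
  have "compactin (powertop_real UNIV) (\<Pi>\<^sub>E i\<in>UNIV. ?S i)"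
    unfolding compactin_PiE by (simp add: compactin_euclidean_iff)
  moreover have "(\<Pi>\<^sub>E i\<in>UNIV. ?S i) \<subseteq> {x. \<forall>i\<ge>m. x i = 0}"
    unfolding eq[symmetric] by (auto simp: closed_box_def topspace_Euclidean_space)
  ultimately show ?thesis
    unfolding eq Euclidean_space_def compactin_subtopology by simp
qed

text \<open>The Lebesgue number argument, for an arbitrary condition on radii that is locally uniform.\<close>

lemma compactin_uniform_radius:
  fixes P :: "'a \<Rightarrow> real \<Rightarrow> bool"
  assumes K: "compactin X K"
    and loc: "\<And>p. p \<in> K \<Longrightarrow> \<exists>W \<delta>. openin X W \<and> p \<in> W \<and> 0 < \<delta> \<and> (\<forall>q\<in>W. P q \<delta>)"
    and anti: "\<And>q \<delta> \<delta>'. P q \<delta> \<Longrightarrow> \<delta>' \<le> \<delta> \<Longrightarrow> P q \<delta>'"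
  obtains \<delta> where "0 < \<delta>" "\<forall>q\<in>K. P q \<delta>"
proof -
  have "\<forall>p\<in>K. \<exists>W \<delta>. openin X W \<and> p \<in> W \<and> 0 < \<delta> \<and> (\<forall>q\<in>W. P q \<delta>)" using loc by simp
  then obtain W d where W: "\<forall>p\<in>K. openin X (W p) \<and> p \<in> W p \<and> 0 < d p \<and> (\<forall>q\<in>W p. P q (d p))"
    by metis
  have "\<exists>\<F>. finite \<F> \<and> \<F> \<subseteq> W ` K \<and> K \<subseteq> \<Union>\<F>"
    using K W unfolding compactin_def by (elim conjE allE[of _ "W ` K"]) blast
  then obtain \<F> where \<F>: "finite \<F>" "\<F> \<subseteq> W ` K" "K \<subseteq> \<Union>\<F>" by blast
  then obtain J where J: "finite J" "J \<subseteq> K" "\<F> = W ` J"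
    by (meson finite_subset_image)
  define \<delta> where "\<delta> = Min (insert 1 (d ` J))"
  have "0 < \<delta>" using J W by (auto simp: \<delta>_def)
  moreover have "\<forall>q\<in>K. P q \<delta>"
  proof
    fix q assume q: "q \<in> K"
    obtain p where p: "p \<in> J" "q \<in> W p" using q \<F>(3) J(3) by blast
    then have "P q (d p)" using W J(2) by blast
    moreover have "\<delta> \<le> d p" using p J(1) by (simp add: \<delta>_def)
    ultimately show "P q \<delta>" by (rule anti)
  qed
  ultimately show ?thesis by (rule that)
qed

section \<open>Lifting boxes through coverings\<close>

text \<open>By compactness some radius \<open>\<delta>\<close> serves at all points of the closed box. The box is then swept out
  from its centre in finitely many homotheties, each moving the points by less than \<open>\<delta>\<close>.\<close>

lemma section_over_compact_box:
  assumes E: "Hausdorff_space E" "locally_injective E D"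
    and loc: "\<And>b. b \<in> closed_box m y \<rho> \<Longrightarrow> \<exists>T. openin (Euclidean_space m) T \<and> b \<in> T \<and>
       (\<forall>e\<in>topspace E. D e \<in> T \<longrightarrow> (\<exists>\<sigma>. section_over E D (Euclidean_space m) T \<sigma> \<and> \<sigma> (D e) = e))"
    and u: "u \<in> topspace E" "D u = y" and y: "y \<in> topspace (Euclidean_space m)" and "0 < \<rho>"
  obtains \<sigma> where "section_over E D (Euclidean_space m) (obox m y \<rho>) \<sigma>" "\<sigma> y = u"
proof -
  let ?X = "Euclidean_space m"
  \<comment> \<open>for \<open>\<delta> \<le> 0\<close> the box may miss its centre; the guard keeps the condition antitone in \<open>\<delta>\<close>\<close>
  define P where "P q \<delta> \<longleftrightarrow> (\<forall>e\<in>topspace E. D e = q \<longrightarrow>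
      (\<exists>\<sigma>. section_over E D ?X (obox m q \<delta>) \<sigma> \<and> (0 < \<delta> \<longrightarrow> \<sigma> q = e)))" for q \<delta>
  have "\<exists>W \<delta>. openin ?X W \<and> p \<in> W \<and> 0 < \<delta> \<and> (\<forall>q\<in>W. P q \<delta>)" if p: "p \<in> closed_box m y \<rho>" for p
  proof -
    obtain T where T: "openin ?X T" "p \<in> T" and
      ex: "\<forall>e\<in>topspace E. D e \<in> T \<longrightarrow> (\<exists>\<sigma>. section_over E D ?X T \<sigma> \<and> \<sigma> (D e) = e)"
      using loc[OF p] by blast
    obtain \<delta> where \<delta>: "0 < \<delta>" "obox m p \<delta> \<subseteq> T" using openin_contains_obox[OF T] .
    have "P q (\<delta> / 2)" if q: "q \<in> obox m p (\<delta> / 2)" for q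
      unfolding P_def
    proof (intro ballI impI)
      fix e assume e: "e \<in> topspace E" "D e = q"
      have sub: "obox m q (\<delta> / 2) \<subseteq> obox m p \<delta>"
      proof
        fix x assume x: "x \<in> obox m q (\<delta> / 2)"
        have "\<bar>x i - p i\<bar> < \<delta>" if "i < m" for i
        proof -
          have "\<bar>x i - q i\<bar> < \<delta> / 2" "\<bar>q i - p i\<bar> < \<delta> / 2"
            using x q that by (simp_all add: obox_def)
          then show ?thesis by linarith
        qed
        then show "x \<in> obox m p \<delta>" using x by (simp add: obox_def)
      qed
      have "q \<in> T" using q obox_mono[of "\<delta> / 2" \<delta> m p] \<delta> by auto
      then obtain \<sigma> where \<sigma>: "section_over E D ?X T \<sigma>" "\<sigma> q = e" using ex e by blast
      have "section_over E D ?X (obox m q (\<delta> / 2)) \<sigma>"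
        by (rule section_over_subset[OF \<sigma>(1) openin_obox subset_trans[OF sub \<delta>(2)]])
      then show "\<exists>\<sigma>. section_over E D ?X (obox m q (\<delta> / 2)) \<sigma> \<and> (0 < \<delta> / 2 \<longrightarrow> \<sigma> q = e)"
        using \<sigma>(2) by blast
    qed
    moreover have "p \<in> obox m p (\<delta> / 2)"
      using p \<delta>(1) by (intro center_in_obox) (simp_all add: closed_box_def)
    ultimately show ?thesis using openin_obox[of m p "\<delta> / 2"] \<delta>(1) half_gt_zero by blast
  qed
  moreover have "P q \<delta>'" if q: "P q \<delta>" "\<delta>' \<le> \<delta>" for q \<delta> \<delta>'
    unfolding P_def
  proof (intro ballI impI)
    fix e assume e: "e \<in> topspace E" "D e = q"
    then obtain \<sigma> where \<sigma>: "section_over E D ?X (obox m q \<delta>) \<sigma>" "0 < \<delta> \<longrightarrow> \<sigma> q = e"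
      using q(1) unfolding P_def by blast
    have "section_over E D ?X (obox m q \<delta>') \<sigma>"
      by (rule section_over_subset[OF \<sigma>(1) openin_obox obox_mono[OF q(2)]])
    moreover have "0 < \<delta>' \<longrightarrow> \<sigma> q = e" using \<sigma>(2) q(2) by linarith
    ultimately show "\<exists>\<sigma>. section_over E D ?X (obox m q \<delta>') \<sigma> \<and> (0 < \<delta>' \<longrightarrow> \<sigma> q = e)" by blast
  qed
  ultimately obtain \<delta> where \<delta>: "0 < \<delta>" "\<forall>q\<in>closed_box m y \<rho>. P q \<delta>"
    by (rule compactin_uniform_radius[OF compactin_closed_box[OF y]])
  obtain N :: nat where N: "\<rho> / \<delta> < real N" using reals_Archimedean2 by blast
  moreover have "0 < \<rho> / \<delta>" using \<open>0 < \<rho>\<close> \<delta>(1) by simp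
  ultimately have "0 < real N" by linarith
  then have N0: "0 < N" by simp
  have step: "\<rho> / real N < \<delta>" using N \<delta>(1) \<open>0 < real N\<close> by (simp add: field_simps)
  define r where "r j = \<rho> * (real (Suc j) / real N)" for j
  have r0: "0 < r j" for j using \<open>0 < \<rho>\<close> N0 by (simp add: r_def)
  have "\<exists>\<sigma>. section_over E D ?X (obox m y (r j)) \<sigma> \<and> \<sigma> y = u" if "j < N" for j
    using that
  proof (induction j)
    case 0
    have "y \<in> closed_box m y \<rho>" using y \<open>0 < \<rho>\<close> by (simp add: closed_box_def)
    then obtain \<sigma> where \<sigma>: "section_over E D ?X (obox m y \<delta>) \<sigma>" "\<sigma> y = u"
      using \<delta> u unfolding P_def by blast
    have "r 0 \<le> \<delta>" using step by (simp add: r_def)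
    from section_over_subset[OF \<sigma>(1) openin_obox obox_mono[OF this]] show ?case using \<sigma>(2) by blast
  next
    case (Suc j)
    then obtain \<sigma> where \<sigma>: "section_over E D ?X (obox m y (r j)) \<sigma>" "\<sigma> y = u" by auto
    define \<mu> where "\<mu> = real (Suc j) / real (Suc (Suc j))"
    have \<mu>: "0 < \<mu>" "\<mu> < 1" by (simp_all add: \<mu>_def)
    have \<mu>r: "\<mu> * r (Suc j) = r j"
      by (simp add: \<mu>_def r_def del: of_nat_Suc)
    have rdiff: "r (Suc j) - r j < \<delta>"
    proof -
      have "r (Suc j) - r j = \<rho> / real N" using N0 by (simp add: r_def field_simps)
      then show ?thesis using step by simp
    qed
    have rj: "r j \<le> \<rho>"
    proof -
      have "real (Suc j) / real N \<le> 1" using Suc.prems N0 by (simp add: field_simps)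
      then have "\<rho> * (real (Suc j) / real N) \<le> \<rho> * 1"
        using \<open>0 < \<rho>\<close> by (intro mult_left_mono) simp_all
      then show ?thesis unfolding r_def by (simp only: mult_1_right)
    qed
    define \<zeta> where "\<zeta> x i = y i + \<mu> * (x i - y i)" for x :: "nat \<Rightarrow> real" and i
    obtain \<tau> where "section_over E D ?X (obox m y (r (Suc j))) \<tau>" "\<tau> y = \<sigma> y"
    proof (rule extend_section[OF E \<sigma>(1) cvx_obox openin_obox[of m y "r (Suc j)"],
          where \<zeta>=\<zeta> and y=y])
      show "continuous_on (obox m y (r (Suc j))) \<zeta>"
      proof (rule continuous_on_coordinatewise_then_product)
        fix i
        show "continuous_on (obox m y (r (Suc j))) (\<lambda>x. \<zeta> x i)"
          unfolding \<zeta>_def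
          by (intro continuous_intros continuous_on_subset[OF continuous_on_product_coordinates subset_UNIV])
      qed
      show "\<zeta> ` obox m y (r (Suc j)) \<subseteq> obox m y (r j)"
      proof clarify
        fix x assume x: "x \<in> obox m y (r (Suc j))"
        have "\<bar>\<zeta> x i - y i\<bar> < r j" if "i < m" for i
        proof -
          have "\<bar>\<zeta> x i - y i\<bar> = \<mu> * \<bar>x i - y i\<bar>" using \<mu> by (simp add: \<zeta>_def abs_mult)
          also have "\<dots> < \<mu> * r (Suc j)" using x that \<mu> by (simp add: obox_def)
          finally show ?thesis using \<mu>r by simp
        qed
        moreover have "\<zeta> x \<in> topspace ?X"
          using x y by (simp add: obox_def topspace_Euclidean_space \<zeta>_def)
        ultimately show "\<zeta> x \<in> obox m y (r j)" by (simp add: obox_def)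
      qed
      show "y \<in> obox m y (r (Suc j))" by (rule center_in_obox[OF y r0])
      show "\<zeta> y = y" by (simp add: \<zeta>_def fun_eq_iff)
      fix z assume z: "z \<in> obox m y (r j)"
      then have Dz: "D (\<sigma> z) = z" "\<sigma> z \<in> topspace E"
        using \<sigma>(1) section_over_in_topspace[OF \<sigma>(1)] by (simp_all add: section_over_def)
      have "z \<in> closed_box m y \<rho>"
        using z rj by (simp add: obox_def closed_box_def) (meson less_le_trans less_imp_le)
      then obtain \<tau> where \<tau>: "section_over E D ?X (obox m z \<delta>) \<tau>" "\<tau> z = \<sigma> z"
        using \<delta> Dz unfolding P_def by blast
      have zX: "z \<in> topspace ?X" using z by (simp add: obox_def)
      have "x \<in> obox m z \<delta>" if x: "x \<in> obox m y (r (Suc j))" "\<zeta> x = z" for x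
      proof -
        have "\<bar>x i - z i\<bar> < \<delta>" if "i < m" for i
        proof -
          have "x i - z i = (1 - \<mu>) * (x i - y i)"
            unfolding x(2)[symmetric] by (simp add: \<zeta>_def algebra_simps)
          then have "\<bar>x i - z i\<bar> = (1 - \<mu>) * \<bar>x i - y i\<bar>" using \<mu> by (simp add: abs_mult)
          also have "\<dots> < (1 - \<mu>) * r (Suc j)" using x(1) that \<mu> by (simp add: obox_def)
          also have "\<dots> = r (Suc j) - r j" using \<mu>r by (simp add: algebra_simps)
          finally show ?thesis using rdiff by linarith
        qed
        then show ?thesis using x(1) by (simp add: obox_def)
      qed
      then have "\<forall>x\<in>obox m y (r (Suc j)). \<zeta> x = z \<longrightarrow> x \<in> obox m z \<delta>" by blast
      with \<tau> cvx_obox[of m z \<delta>] center_in_obox[OF zX \<delta>(1)]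
      show "\<exists>P \<tau>. section_over E D ?X P \<tau> \<and> cvx P \<and> z \<in> P \<and> \<tau> z = \<sigma> z \<and>
          (\<forall>x\<in>obox m y (r (Suc j)). \<zeta> x = z \<longrightarrow> x \<in> P)"
        by (intro exI[of _ "obox m z \<delta>"] exI[of _ \<tau>] conjI)
    qed (rule that)
    then show ?case using \<sigma>(2) by auto
  qed
  from this[of "N - 1"] obtain \<sigma> where "section_over E D ?X (obox m y (r (N - 1))) \<sigma>" "\<sigma> y = u"
    using N0 by auto
  moreover have "r (N - 1) = \<rho>" using N0 by (simp add: r_def)
  ultimately show ?thesis using that by metis
qed

lemma covering_map_evenly_covered:
  assumes "covering_map E \<pi> N" "b \<in> topspace N"
  obtains T \<V> where "b \<in> T" "openin N T" "\<Union>\<V> = {x \<in> topspace E. \<pi> x \<in> T}" "\<forall>V\<in>\<V>. openin E V"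
    "pairwise disjnt \<V>" "\<forall>V\<in>\<V>. homeomorphic_map (subtopology E V) (subtopology N T) \<pi>"
proof -
  have "\<forall>b\<in>topspace N. \<exists>T. b \<in> T \<and> openin N T \<and>
        (\<exists>\<V>. \<Union>\<V> = {x \<in> topspace E. \<pi> x \<in> T} \<and> (\<forall>V\<in>\<V>. openin E V) \<and> pairwise disjnt \<V> \<and>
             (\<forall>V\<in>\<V>. homeomorphic_map (subtopology E V) (subtopology N T) \<pi>))"
    using assms(1) unfolding covering_map_def by (elim conjE)
  from bspec[OF this assms(2)] show ?thesis by (elim exE conjE) (rule that)
qed

lemma covering_map_sections:
  assumes "covering_map E \<pi> N" "b \<in> topspace N"
  obtains T where "b \<in> T" "openin N T"
    "\<forall>u\<in>topspace E. \<pi> u \<in> T \<longrightarrow> (\<exists>\<sigma>. section_over E \<pi> N T \<sigma> \<and> \<sigma> (\<pi> u) = u)"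
proof -
  obtain T \<V> where T: "b \<in> T" "openin N T" "\<Union>\<V> = {x \<in> topspace E. \<pi> x \<in> T}"
      and "\<forall>V\<in>\<V>. openin E V" "pairwise disjnt \<V>"
      and hom: "\<forall>V\<in>\<V>. homeomorphic_map (subtopology E V) (subtopology N T) \<pi>"
    by (rule covering_map_evenly_covered[OF assms])
  have top: "topspace (subtopology N T) = T" using openin_subset[OF T(2)] by auto
  show ?thesis
  proof (rule that[OF T(1,2)], intro ballI impI)
    fix u assume u: "u \<in> topspace E" "\<pi> u \<in> T"
    then obtain V where V: "V \<in> \<V>" "u \<in> V" using T(3) by blast
    then obtain \<sigma> where "homeomorphic_maps (subtopology E V) (subtopology N T) \<pi> \<sigma>"
      using hom homeomorphic_map_maps by blast
    then have \<sigma>: "continuous_map (subtopology N T) (subtopology E V) \<sigma>" "\<forall>x\<in>T. \<pi> (\<sigma> x) = x"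
        "\<forall>x\<in>topspace (subtopology E V). \<sigma> (\<pi> x) = x"
      unfolding homeomorphic_maps_def top by simp_all
    have "section_over E \<pi> N T \<sigma>"
      using T(2) \<sigma>(2) continuous_map_into_fulltopology[OF \<sigma>(1)] by (simp add: section_over_def)
    moreover have "\<sigma> (\<pi> u) = u" using \<sigma>(3) u V by simp
    ultimately show "\<exists>\<sigma>. section_over E \<pi> N T \<sigma> \<and> \<sigma> (\<pi> u) = u" by blast
  qed
qed

lemma covering_map_locally_injective:
  assumes "covering_map E \<pi> N"
  shows "locally_injective E \<pi>"
  unfolding locally_injective_def
proof
  fix u assume u: "u \<in> topspace E"
  then have "\<pi> u \<in> topspace N" using assms by (auto simp: covering_map_def)
  then obtain T \<V> where T: "\<pi> u \<in> T" and "openin N T"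
      and T2: "\<Union>\<V> = {x \<in> topspace E. \<pi> x \<in> T}" "\<forall>V\<in>\<V>. openin E V" and "pairwise disjnt \<V>"
      and hom: "\<forall>V\<in>\<V>. homeomorphic_map (subtopology E V) (subtopology N T) \<pi>"
    by (rule covering_map_evenly_covered[OF assms])
  from T u have "u \<in> \<Union>\<V>" unfolding T2(1) by simp
  then obtain V where V: "V \<in> \<V>" "u \<in> V" by blast
  then have "openin E V" "inj_on \<pi> (topspace (subtopology E V))"
    using T2(2) hom homeomorphic_imp_injective_map by blast+
  moreover have "topspace (subtopology E V) = V" using openin_subset[OF calculation(1)] by auto
  ultimately show "\<exists>W. openin E W \<and> u \<in> W \<and> inj_on \<pi> W" using V(2) by metis
qed

text \<open>Distinct points of one fibre are separated by the sheets that contain them.\<close>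

lemma covering_map_Hausdorff:
  assumes cov: "covering_map E \<pi> N" and N: "Hausdorff_space N"
  shows "Hausdorff_space E"
  unfolding Hausdorff_space_def
proof (intro allI impI)
  fix x y assume xy: "x \<in> topspace E \<and> y \<in> topspace E \<and> x \<noteq> y"
  have c: "continuous_map E N \<pi>" using cov by (simp add: covering_map_def)
  have px: "\<pi> x \<in> topspace N" "\<pi> y \<in> topspace N" using c xy by (auto simp: continuous_map_def)
  show "\<exists>U V. openin E U \<and> openin E V \<and> x \<in> U \<and> y \<in> V \<and> disjnt U V"
  proof (cases "\<pi> x = \<pi> y")
    case False
    then obtain U V where UV: "openin N U" "openin N V" "\<pi> x \<in> U" "\<pi> y \<in> V" "disjnt U V"
      using N px unfolding Hausdorff_space_def by metis
    show ?thesis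
    proof (intro exI conjI)
      show "openin E {z \<in> topspace E. \<pi> z \<in> U}" "openin E {z \<in> topspace E. \<pi> z \<in> V}"
        using UV c openin_continuous_map_preimage by blast+
    qed (use UV xy in \<open>auto simp: disjnt_def\<close>)
  next
    case True
    obtain T \<V> where T1: "\<pi> x \<in> T" and "openin N T"
        and T: "\<Union>\<V> = {x \<in> topspace E. \<pi> x \<in> T}" "\<forall>V\<in>\<V>. openin E V" "pairwise disjnt \<V>"
        and hom: "\<forall>V\<in>\<V>. homeomorphic_map (subtopology E V) (subtopology N T) \<pi>"
      by (rule covering_map_evenly_covered[OF cov px(1)])
    obtain U V where UV: "U \<in> \<V>" "x \<in> U" "V \<in> \<V>" "y \<in> V"
    proof -
      have "x \<in> \<Union>\<V>" "y \<in> \<Union>\<V>" unfolding T(1) using T1 True xy by simp_all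
      then show ?thesis using that by blast
    qed
    have "U \<noteq> V"
    proof
      assume "U = V"
      have "inj_on \<pi> (topspace (subtopology E U))"
        using hom UV(1) homeomorphic_imp_injective_map by blast
      moreover have "x \<in> topspace (subtopology E U)" "y \<in> topspace (subtopology E U)"
        using UV \<open>U = V\<close> xy by auto
      ultimately show False using True xy by (auto dest: inj_onD)
    qed
    then have "disjnt U V" using T(3) UV by (simp add: pairwise_def)
    then show ?thesis using UV T(2) by blast
  qed
qed

lemma chart_inverse:
  assumes "is_chart m N (C, \<xi>)"
  obtains \<eta> where "section_over N \<xi> (Euclidean_space m) (\<xi> ` C) \<eta>" "\<forall>p\<in>C. \<eta> (\<xi> p) = p"
    "\<eta> ` \<xi> ` C = C"
proof -
  have ch: "openin N C" "openin (Euclidean_space m) (\<xi> ` C)"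
      "homeomorphic_map (subtopology N C) (subtopology (Euclidean_space m) (\<xi> ` C)) \<xi>"
    using assms by (auto simp: is_chart_def)
  have top: "topspace (subtopology N C) = C"
      "topspace (subtopology (Euclidean_space m) (\<xi> ` C)) = \<xi> ` C"
    using openin_subset[OF ch(1)] openin_subset[OF ch(2)] by auto
  obtain \<eta> where "homeomorphic_maps (subtopology N C) (subtopology (Euclidean_space m) (\<xi> ` C)) \<xi> \<eta>"
    using ch(3) homeomorphic_map_maps by blast
  then have \<eta>: "continuous_map (subtopology (Euclidean_space m) (\<xi> ` C)) (subtopology N C) \<eta>"
      "\<forall>p\<in>C. \<eta> (\<xi> p) = p" "\<forall>x\<in>\<xi> ` C. \<xi> (\<eta> x) = x"
    unfolding homeomorphic_maps_def top by simp_all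
  show ?thesis
  proof
    show "section_over N \<xi> (Euclidean_space m) (\<xi> ` C) \<eta>"
      using ch(2) \<eta>(3) continuous_map_into_fulltopology[OF \<eta>(1)] by (simp add: section_over_def)
    show "\<forall>p\<in>C. \<eta> (\<xi> p) = p" by (rule \<eta>(2))
    show "\<eta> ` \<xi> ` C = C" using \<eta>(2) by (simp add: image_image)
  qed
qed

text \<open>On the part of \<open>E\<close> above \<open>C\<close>, lifting the inverse of \<open>\<xi>\<close> through \<open>\<pi>\<close> means finding a section of
  \<open>\<xi> \<circ> \<pi>\<close>. Near each point of \<open>\<xi> ` C\<close> such sections come from the sheets of \<open>\<pi>\<close>, and
  \<open>section_over_compact_box\<close> continues them to the box.\<close>

lemma lift_box_in_chart:
  assumes cov: "covering_map E \<pi> N" and N: "Hausdorff_space N"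
    and chart: "is_chart m N (C, \<xi>)" and u: "u \<in> topspace E" "\<pi> u \<in> C" and "0 < \<rho>"
    and box: "closed_box m (\<xi> (\<pi> u)) \<rho> \<subseteq> \<xi> ` C"
  obtains \<sigma> where "continuous_map (subtopology (Euclidean_space m) (obox m (\<xi> (\<pi> u)) \<rho>)) E \<sigma>"
    "\<forall>x\<in>obox m (\<xi> (\<pi> u)) \<rho>. \<pi> (\<sigma> x) \<in> C \<and> \<xi> (\<pi> (\<sigma> x)) = x" "\<sigma> (\<xi> (\<pi> u)) = u"
proof -
  let ?X = "Euclidean_space m"
  let ?y = "\<xi> (\<pi> u)"
  obtain \<eta> where \<eta>: "section_over N \<xi> ?X (\<xi> ` C) \<eta>" "\<forall>p\<in>C. \<eta> (\<xi> p) = p" "\<eta> ` \<xi> ` C = C"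
    by (rule chart_inverse[OF chart])
  have C: "openin N C" and \<xi>C: "openin ?X (\<xi> ` C)" using chart by (auto simp: is_chart_def)
  have \<pi>c: "continuous_map E N \<pi>" using cov by (simp add: covering_map_def)
  define S where "S = {e \<in> topspace E. \<pi> e \<in> C}"
  have S: "openin E S" unfolding S_def by (rule openin_continuous_map_preimage[OF \<pi>c C])
  let ?E = "subtopology E S"
  let ?D = "\<xi> \<circ> \<pi>"
  have topE: "topspace ?E = S" using openin_subset[OF S] by auto
  have inj: "inj_on \<xi> C" using \<eta>(2) by (metis inj_onI)
  have H: "Hausdorff_space ?E"
    by (rule Hausdorff_space_subtopology[OF covering_map_Hausdorff[OF cov N]])
  have L: "locally_injective ?E ?D"
    unfolding locally_injective_def topE
  proof
    fix e assume e: "e \<in> S"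
    then obtain W where W: "openin E W" "e \<in> W" "inj_on \<pi> W"
      using covering_map_locally_injective[OF cov] unfolding locally_injective_def S_def by blast
    have "inj_on ?D (W \<inter> S)"
      using W(3) inj by (auto simp: inj_on_def S_def)
    moreover have "openin ?E (W \<inter> S)" using W(1) openin_subtopology by blast
    ultimately show "\<exists>W. openin ?E W \<and> e \<in> W \<and> inj_on ?D W" using e W(2) by blast
  qed
  have loc: "\<exists>T. openin ?X T \<and> b \<in> T \<and>
      (\<forall>e\<in>topspace ?E. ?D e \<in> T \<longrightarrow> (\<exists>\<sigma>. section_over ?E ?D ?X T \<sigma> \<and> \<sigma> (?D e) = e))"
    if b: "b \<in> closed_box m ?y \<rho>" for b
  proof -
    have "b \<in> \<xi> ` C" using b box by blast
    then have \<eta>b: "\<eta> b \<in> C" "\<xi> (\<eta> b) = b" using \<eta> by auto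
    then have "\<eta> b \<in> topspace N" using openin_subset[OF C] by blast
    then obtain T0 where T0: "\<eta> b \<in> T0" "openin N T0"
      "\<forall>u\<in>topspace E. \<pi> u \<in> T0 \<longrightarrow> (\<exists>\<sigma>. section_over E \<pi> N T0 \<sigma> \<and> \<sigma> (\<pi> u) = u)"
      by (rule covering_map_sections[OF cov])
    define T where "T = {x \<in> \<xi> ` C. \<eta> x \<in> T0}"
    have top\<xi>: "topspace (subtopology ?X (\<xi> ` C)) = \<xi> ` C" using openin_subset[OF \<xi>C] by auto
    have \<eta>c: "continuous_map (subtopology ?X (\<xi> ` C)) N \<eta>" using \<eta>(1) by (simp add: section_over_def)
    have "openin (subtopology ?X (\<xi> ` C)) T"
      using openin_continuous_map_preimage[OF \<eta>c T0(2)] unfolding top\<xi> T_def .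
    then have T: "openin ?X T" using \<xi>C openin_trans_full by blast
    have T\<xi>: "T \<subseteq> \<xi> ` C" by (auto simp: T_def)
    have \<eta>cT: "continuous_map (subtopology ?X T) (subtopology N T0) \<eta>"
      using continuous_map_from_subtopology_mono[OF \<eta>c T\<xi>]
      by (auto simp: continuous_map_in_subtopology T_def)
    have "\<exists>\<sigma>. section_over ?E ?D ?X T \<sigma> \<and> \<sigma> (?D e) = e" if e: "e \<in> topspace ?E" "?D e \<in> T" for e
    proof -
      have e': "e \<in> topspace E" "\<pi> e \<in> C" using e(1) unfolding topE S_def by auto
      then have "\<pi> e \<in> T0" using e(2) bspec[OF \<eta>(2) e'(2)] by (simp add: T_def)
      then obtain \<sigma> where \<sigma>: "section_over E \<pi> N T0 \<sigma>" "\<sigma> (\<pi> e) = e" using T0(3) e'(1) by blast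
      have in_C: "\<pi> (\<sigma> (\<eta> x)) = \<eta> x \<and> \<eta> x \<in> C" if "x \<in> T" for x
      proof
        have "\<eta> x \<in> T0" using that by (simp add: T_def)
        then show "\<pi> (\<sigma> (\<eta> x)) = \<eta> x" using \<sigma>(1) by (simp add: section_over_def)
        show "\<eta> x \<in> C" using that T\<xi> \<eta>(3) by blast
      qed
      have "continuous_map (subtopology ?X T) E (\<sigma> \<circ> \<eta>)"
        using \<sigma>(1) by (intro continuous_map_compose[OF \<eta>cT]) (simp add: section_over_def)
      moreover have "(\<sigma> \<circ> \<eta>) x \<in> S" if "x \<in> T" for x
      proof -
        have "\<eta> x \<in> T0" using that by (simp add: T_def)
        then have "\<sigma> (\<eta> x) \<in> topspace E" by (rule section_over_in_topspace[OF \<sigma>(1)])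
        then show ?thesis using in_C[OF that] by (simp add: S_def)
      qed
      ultimately have "continuous_map (subtopology ?X T) ?E (\<sigma> \<circ> \<eta>)"
        unfolding continuous_map_in_subtopology by auto
      moreover have "?D ((\<sigma> \<circ> \<eta>) x) = x" if "x \<in> T" for x
        using in_C[OF that] that T\<xi> \<eta>(1) by (auto simp: section_over_def)
      ultimately have "section_over ?E ?D ?X T (\<sigma> \<circ> \<eta>)" using T by (simp add: section_over_def)
      moreover have "(\<sigma> \<circ> \<eta>) (?D e) = e" using bspec[OF \<eta>(2) e'(2)] \<sigma>(2) by simp
      ultimately show ?thesis by blast
    qed
    moreover have "b \<in> T" using \<open>b \<in> \<xi> ` C\<close> T0(1) by (simp add: T_def)
    ultimately show ?thesis using T by blast
  qed
  have y: "?y \<in> topspace ?X" using u(2) openin_subset[OF \<xi>C] by blast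
  have uS: "u \<in> topspace ?E" unfolding topE S_def using u by simp
  obtain \<sigma> where \<sigma>: "section_over ?E ?D ?X (obox m ?y \<rho>) \<sigma>" "\<sigma> ?y = u"
    by (rule section_over_compact_box[OF H L loc uS o_apply y \<open>0 < \<rho>\<close>])
  show ?thesis
  proof
    show "continuous_map (subtopology ?X (obox m ?y \<rho>)) E \<sigma>"
      using \<sigma>(1) unfolding section_over_def by (blast intro: continuous_map_into_fulltopology)
    show "\<sigma> ?y = u" by (rule \<sigma>(2))
    show "\<forall>x\<in>obox m ?y \<rho>. \<pi> (\<sigma> x) \<in> C \<and> \<xi> (\<pi> (\<sigma> x)) = x"
    proof
      fix x assume x: "x \<in> obox m ?y \<rho>"
      then have "\<sigma> x \<in> S" using section_over_in_topspace[OF \<sigma>(1)] topE by blast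
      moreover have "?D (\<sigma> x) = x" using \<sigma>(1) x by (simp add: section_over_def)
      ultimately show "\<pi> (\<sigma> x) \<in> C \<and> \<xi> (\<pi> (\<sigma> x)) = x" by (simp add: S_def)
    qed
  qed
qed

section \<open>Affine maps\<close>

definition affine_on_segments :: "trafo \<Rightarrow> bool" where
  "affine_on_segments g \<longleftrightarrow> (\<forall>t x y. g (seg t x y) = seg t (g x) (g y))"

lemma affine_on_segments_comp:
  "affine_on_segments g \<Longrightarrow> affine_on_segments h \<Longrightarrow> affine_on_segments (\<lambda>x. g (h x))"
  by (simp add: affine_on_segments_def)

text \<open>The line from \<open>p\<close> to \<open>y\<close> has a second point in \<open>W\<close>, and an affine map is determined on a line by
  two values.\<close>

lemma affine_determined_by_germ:
  assumes "affine_on_segments g" "affine_on_segments h"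
    and W: "openin (Euclidean_space m) W" "p \<in> W" and eq: "\<And>x. x \<in> W \<Longrightarrow> g x = h x"
    and y: "y \<in> topspace (Euclidean_space m)"
  shows "g y = h y"
proof -
  obtain \<delta> where \<delta>: "0 < \<delta>" "obox m p \<delta> \<subseteq> W" by (rule openin_contains_obox[OF W])
  have p: "p \<in> topspace (Euclidean_space m)" using W openin_subset by blast
  define S where "S = (\<Sum>i<m. \<bar>y i - p i\<bar>)"
  have S: "0 \<le> S" "\<And>i. i < m \<Longrightarrow> \<bar>y i - p i\<bar> \<le> S"
    unfolding S_def by (simp add: sum_nonneg) (rule member_le_sum, simp_all)
  \<comment> \<open>small enough for \<open>seg t p y\<close> to stay within \<open>\<delta>\<close> of \<open>p\<close>\<close>
  define t where "t = \<delta> / (1 + S)"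
  have t: "0 < t" "t * (1 + S) = \<delta>" using \<delta>(1) S(1) by (simp_all add: t_def)
  have "\<bar>seg t p y i - p i\<bar> < \<delta>" if i: "i < m" for i
  proof -
    have "\<bar>seg t p y i - p i\<bar> = t * \<bar>y i - p i\<bar>"
    proof -
      have "seg t p y i - p i = t * (y i - p i)" by (simp add: seg_def algebra_simps)
      then show ?thesis using t(1) by (simp add: abs_mult)
    qed
    also have "\<dots> < t * (1 + S)" using S(2)[OF i] t(1) by (intro mult_strict_left_mono) linarith+
    finally show ?thesis using t(2) by simp
  qed
  then have "seg t p y \<in> obox m p \<delta>" using seg_in_topspace[OF p y] by (simp add: obox_def)
  then have "g (seg t p y) = h (seg t p y)" using \<delta>(2) eq by blast
  then have "seg t (g p) (g y) = seg t (h p) (h y)" using assms(1,2) by (simp add: affine_on_segments_def)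
  moreover have "g p = h p" using eq W(2) by blast
  ultimately have "t * g y i = t * h y i" for i by (auto simp: seg_def fun_eq_iff)
  then show ?thesis using t(1) by (simp add: fun_eq_iff)
qed

text \<open>By \<open>affine_determined_by_germ\<close>, the set where \<open>f\<close> has the germ of a given \<open>h0\<close> is open and closed.
  For developing maps this is the reason why the germ of \<open>Dev\<close> at one point determines it above a
  whole box.\<close>

lemma locally_affine_imp_affine:
  assumes \<Omega>: "openin (Euclidean_space m) \<Omega>" "cvx \<Omega>" and y: "y \<in> \<Omega>"
    and H: "\<And>h. h \<in> H \<Longrightarrow> affine_on_segments h"
    and loc: "\<And>x. x \<in> \<Omega> \<Longrightarrow> \<exists>W h. openin (Euclidean_space m) W \<and> x \<in> W \<and> h \<in> H \<and> (\<forall>z\<in>W. f z = h z)"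
  obtains h where "h \<in> H" "\<forall>x\<in>\<Omega>. f x = h x"
proof -
  let ?X = "Euclidean_space m"
  obtain W0 h0 where W0: "openin ?X W0" "y \<in> W0" "h0 \<in> H" "\<forall>z\<in>W0. f z = h0 z"
    using loc[OF y] by blast
  define A where "A = {x \<in> \<Omega>. \<exists>W. openin ?X W \<and> x \<in> W \<and> (\<forall>z\<in>W. f z = h0 z)}"
  have A\<Omega>: "A \<subseteq> \<Omega>" by (auto simp: A_def)
  have openA: "openin ?X A"
  proof (subst openin_subopen, intro ballI)
    fix x assume "x \<in> A"
    then obtain W where W: "openin ?X W" "x \<in> W" "\<forall>z\<in>W. f z = h0 z" "x \<in> \<Omega>"
      unfolding A_def by blast
    then have "W \<inter> \<Omega> \<subseteq> A" unfolding A_def by blast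
    then show "\<exists>T. openin ?X T \<and> x \<in> T \<and> T \<subseteq> A"
      using W(1,2,4) openin_Int[OF W(1) \<Omega>(1)] by blast
  qed
  have "y \<in> A" unfolding A_def using W0 y by blast
  have "\<Omega> \<subseteq> A"
  proof (rule connectedin_subset_if_separated[OF connectedin_cvx[OF \<Omega>(2) openin_subset[OF \<Omega>(1)]]
        openA y \<open>y \<in> A\<close>])
    fix x assume x: "x \<in> \<Omega>" "x \<notin> A"
    obtain W h where W: "openin ?X W" "x \<in> W" "h \<in> H" "\<forall>z\<in>W. f z = h z"
      using loc[OF x(1)] by blast
    have "W \<inter> A = {}"
    proof (rule ccontr)
      assume "W \<inter> A \<noteq> {}"
      then obtain p W' where p: "p \<in> W" "openin ?X W'" "p \<in> W'" "\<forall>z\<in>W'. f z = h0 z"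
        unfolding A_def by blast
      have eq: "h z = h0 z" if "z \<in> topspace ?X" for z
      proof (rule affine_determined_by_germ[OF H[OF W(3)] H[OF W0(3)] openin_Int[OF W(1) p(2)] _ _ that])
        show "p \<in> W \<inter> W'" using p by blast
        show "h x = h0 x" if "x \<in> W \<inter> W'" for x
          using that W(4) p(4) by (metis IntD1 IntD2)
      qed
      have "\<forall>z\<in>W. f z = h0 z"
      proof
        fix z assume z: "z \<in> W"
        then have "z \<in> topspace ?X" using openin_subset[OF W(1)] by blast
        then show "f z = h0 z" using eq W(4) z by simp
      qed
      then have "x \<in> A" unfolding A_def using x(1) W(1,2) by blast
      then show False using x(2) by simp
    qed
    then show "\<exists>T. openin ?X T \<and> x \<in> T \<and> T \<inter> A = {}" using W(1,2) by blast
  qed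
  then have "\<forall>x\<in>\<Omega>. f x = h0 x" unfolding A_def by blast
  then show ?thesis by (rule that[OF W0(3)])
qed

section \<open>The action of the group\<close>

text \<open>A left inverse of a square matrix is a right inverse, applied to the transpose.\<close>

lemma orthogonal_rows:
  fixes a :: "nat \<Rightarrow> nat \<Rightarrow> real"
  assumes "\<forall>i<n. \<forall>j<n. (\<Sum>l<n. a l i * a l j) = (if i = j then 1 else 0)"
  shows "\<forall>i<n. \<forall>j<n. (\<Sum>l<n. a i l * a j l) = (if i = j then 1 else 0)"
proof -
  define A where "A = mat n n (\<lambda>(i, j). a i j)"
  have A: "A \<in> carrier_mat n n" by (simp add: A_def)
  have left: "A\<^sup>T * A = 1\<^sub>m n"
  proof (rule eq_matI)
    fix i j assume "i < dim_row (1\<^sub>m n)" "j < dim_col (1\<^sub>m n)"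
    then have ij: "i < n" "j < n" by simp_all
    then have "(A\<^sup>T * A) $$ (i, j) = (\<Sum>l<n. a l i * a l j)"
      by (simp add: A_def scalar_prod_def lessThan_atLeast0)
    then show "(A\<^sup>T * A) $$ (i, j) = 1\<^sub>m n $$ (i, j)" using assms ij by simp
  qed (simp_all add: A_def)
  have *: "A * A\<^sup>T = 1\<^sub>m n"
    by (rule mat_mult_left_right_inverse[OF _ A left]) (use A in simp)
  show ?thesis
  proof (intro allI impI)
    fix i j assume ij: "i < n" "j < n"
    then have "(A * A\<^sup>T) $$ (i, j) = (\<Sum>l<n. a i l * a j l)"
      by (simp add: A_def scalar_prod_def lessThan_atLeast0)
    then show "(\<Sum>l<n. a i l * a j l) = (if i = j then 1 else 0)" using * ij by simp
  qed
qed

lemma sum_orthogonal: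
  fixes a :: "nat \<Rightarrow> nat \<Rightarrow> real"
  assumes "\<forall>i<n. \<forall>j<n. (\<Sum>l<n. a l i * a l j) = (if i = j then 1 else 0)" and "i < n"
  shows "(\<Sum>l<n. a l i * (\<Sum>j<n. a l j * f j)) = f i"
proof -
  have "(\<Sum>l<n. a l i * (\<Sum>j<n. a l j * f j)) = (\<Sum>l<n. \<Sum>j<n. a l i * a l j * f j)"
    by (simp add: sum_distrib_left mult.assoc)
  also have "\<dots> = (\<Sum>j<n. \<Sum>l<n. a l i * a l j * f j)" by (rule sum.swap)
  also have "\<dots> = (\<Sum>j<n. (\<Sum>l<n. a l i * a l j) * f j)" by (simp add: sum_distrib_right)
  also have "\<dots> = (\<Sum>j<n. if i = j then f j else 0)"
    using assms by (intro sum.cong) auto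
  also have "\<dots> = f i" using assms(2) by simp
  finally show ?thesis .
qed

lemma L2_set_orthogonal:
  fixes a :: "nat \<Rightarrow> nat \<Rightarrow> real"
  assumes "\<forall>i<n. \<forall>j<n. (\<Sum>l<n. a l i * a l j) = (if i = j then 1 else 0)"
  shows "L2_set (\<lambda>i. \<Sum>j<n. a i j * f j) {..<n} = L2_set f {..<n}"
proof -
  have "(\<Sum>i<n. (\<Sum>j<n. a i j * f j)\<^sup>2) = (\<Sum>i<n. \<Sum>j<n. f j * (a i j * (\<Sum>k<n. a i k * f k)))"
    by (simp add: power2_eq_square sum_distrib_right mult_ac)
  also have "\<dots> = (\<Sum>j<n. \<Sum>i<n. f j * (a i j * (\<Sum>k<n. a i k * f k)))" by (rule sum.swap)
  also have "\<dots> = (\<Sum>j<n. f j * (\<Sum>i<n. a i j * (\<Sum>k<n. a i k * f k)))" by (simp add: sum_distrib_left)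
  also have "\<dots> = (\<Sum>j<n. (f j)\<^sup>2)"
    using sum_orthogonal[OF assms] by (intro sum.cong) (simp_all add: power2_eq_square)
  finally show ?thesis by (simp add: L2_set_def)
qed

lemma continuous_on_affine_map: "continuous_on UNIV (affine_map m a v)"
  unfolding affine_map_def
proof (rule continuous_on_coordinatewise_then_product)
  fix i
  show "continuous_on UNIV (\<lambda>x. if i < m then (\<Sum>j<m. a i j * x j) + v i else 0)"
    by (cases "i < m") (simp_all, intro continuous_intros continuous_on_product_coordinates)
qed

lemma Lu_star_affine:
  assumes "g \<in> Lu_star n"
  shows "affine_on_segments g"
proof -
  obtain a v where g: "g = affine_map (Suc n) a v" using assms by (auto simp: Lu_star_def)
  have "affine_map (Suc n) a v (seg t x y) i = seg t (affine_map (Suc n) a v x) (affine_map (Suc n) a v y) i"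
    for t x y i
  proof -
    have "(\<Sum>j<Suc n. a i j * seg t x y j) =
        (1 - t) * (\<Sum>j<Suc n. a i j * x j) + t * (\<Sum>j<Suc n. a i j * y j)"
      unfolding sum_distrib_left sum.distrib[symmetric]
      by (intro sum.cong) (simp_all add: seg_def algebra_simps)
    then show ?thesis
      unfolding affine_map_def by (simp add: seg_def del: sum.lessThan_Suc) (simp add: algebra_simps)
  qed
  then show ?thesis unfolding affine_on_segments_def g by (simp add: fun_eq_iff)
qed

lemma Lu_star_inverse:
  assumes "g \<in> Lu_star n"
  obtains h where "continuous_on UNIV h" "h ` topspace (Euclidean_space (Suc n)) \<subseteq> topspace (Euclidean_space (Suc n))"
    "\<forall>x\<in>topspace (Euclidean_space (Suc n)). h (g x) = x"
    "\<forall>y\<in>topspace (Euclidean_space (Suc n)). g (h y) = y"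
proof -
  obtain a v where g: "g = affine_map (Suc n) a v"
    and orth: "\<forall>i<n. \<forall>j<n. (\<Sum>l<n. a l i * a l j) = (if i = j then 1 else 0)"
    and last: "\<forall>j<n. a n j = 0" "a n n = 1"
    using assms by (auto simp: Lu_star_def)
  \<comment> \<open>what remains of \<open>y\<close> after the translation and the last column are undone, to be multiplied by
    the transpose of the orthogonal block\<close>
  define w where "w y l = y l - v l - a l n * (y n - v n)" for y l
  define h where "h y = (\<lambda>i. if i < n then \<Sum>l<n. a l i * w y l else if i = n then y n - v n else 0)"
    for y :: "nat \<Rightarrow> real"
  have gi: "g x i = (\<Sum>j<n. a i j * x j) + a i n * x n + v i" if "i < n" for x i
    using that by (simp add: g affine_map_def)
  have gn: "g x n = x n + v n" for x
    using last by (simp add: g affine_map_def)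
  have g0: "g x i = 0" if "n < i" for x i
    using that by (simp add: g affine_map_def)
  show ?thesis
  proof
    show "continuous_on UNIV h"
    proof (rule continuous_on_coordinatewise_then_product)
      fix i
      show "continuous_on UNIV (\<lambda>y. h y i)"
        unfolding h_def w_def
        by (cases "i < n"; cases "i = n")
           (simp_all, (intro continuous_intros continuous_on_product_coordinates)+)
    qed
    show "h ` topspace (Euclidean_space (Suc n)) \<subseteq> topspace (Euclidean_space (Suc n))"
      by (auto simp: topspace_Euclidean_space h_def)
    show "\<forall>x\<in>topspace (Euclidean_space (Suc n)). h (g x) = x"
    proof (intro ballI ext)
      fix x i assume x: "x \<in> topspace (Euclidean_space (Suc n))"
      have w: "w (g x) l = (\<Sum>j<n. a l j * x j)" if "l < n" for l
        using that by (simp add: w_def gi gn)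
      consider "i < n" | "i = n" | "n < i" by linarith
      then show "h (g x) i = x i"
      proof cases
        case 1
        then have "h (g x) i = (\<Sum>l<n. a l i * (\<Sum>j<n. a l j * x j))" by (simp add: h_def w)
        then show ?thesis using sum_orthogonal[OF orth 1] by simp
      next
        case 2 then show ?thesis by (simp add: h_def gn)
      next
        case 3 then show ?thesis using x by (simp add: h_def topspace_Euclidean_space)
      qed
    qed
    show "\<forall>y\<in>topspace (Euclidean_space (Suc n)). g (h y) = y"
    proof (intro ballI ext)
      fix y i assume y: "y \<in> topspace (Euclidean_space (Suc n))"
      have hn: "h y n = y n - v n" by (simp add: h_def)
      consider "i < n" | "i = n" | "n < i" by linarith
      then show "g (h y) i = y i"
      proof cases
        case 1
        have rows: "\<forall>i<n. \<forall>j<n. (\<Sum>l<n. a i l * a j l) = (if i = j then 1 else 0)"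
          by (rule orthogonal_rows[OF orth])
        have "(\<Sum>j<n. a i j * h y j) = (\<Sum>j<n. a i j * (\<Sum>l<n. a l j * w y l))"
          by (simp add: h_def)
        also have "\<dots> = w y i" using sum_orthogonal[of n "\<lambda>l j. a j l", OF rows 1] .
        finally show ?thesis using 1 by (simp add: gi hn w_def)
      next
        case 2 then show ?thesis by (simp add: gn hn)
      next
        case 3 then show ?thesis using y by (simp add: g0 topspace_Euclidean_space)
      qed
    qed
  qed
qed

lemma Lu_star_in_topspace:
  "g \<in> Lu_star n \<Longrightarrow> g x \<in> topspace (Euclidean_space (Suc n))"
  by (auto simp: Lu_star_def affine_map_def topspace_Euclidean_space)

lemma Lu_star_continuous: "g \<in> Lu_star n \<Longrightarrow> continuous_on UNIV g"
  using continuous_on_affine_map by (auto simp: Lu_star_def)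

text \<open>The orthogonal block preserves the norms of the horizontal deviations from the axis; the column
  \<open>a i n\<close> and the block together only change the slope of the axis.\<close>

lemma Lu_star_scyl:
  assumes "g \<in> Lu_star n"
  obtains \<gamma> where "\<forall>x\<in>topspace (Euclidean_space (Suc n)). x \<in> scyl n q \<beta> r e \<longleftrightarrow> g x \<in> scyl n (g q) \<gamma> r e"
proof -
  obtain a v where g: "g = affine_map (Suc n) a v"
    and orth: "\<forall>i<n. \<forall>j<n. (\<Sum>l<n. a l i * a l j) = (if i = j then 1 else 0)"
    and last: "\<forall>j<n. a n j = 0" "a n n = 1"
    using assms by (auto simp: Lu_star_def)
  have gi: "g x i = (\<Sum>j<n. a i j * x j) + a i n * x n + v i" if "i < n" for x i
    using that by (simp add: g affine_map_def)
  have gn: "g x n = x n + v n" for x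
    using last by (simp add: g affine_map_def)
  define \<gamma> where "\<gamma> i = (\<Sum>j<n. a i j * \<beta> j) + a i n" for i
  have "L2_set (\<lambda>i. g x i - g q i - \<gamma> i * (g x n - g q n)) {..<n} =
      L2_set (\<lambda>i. x i - q i - \<beta> i * (x n - q n)) {..<n}" for x
  proof -
    have "g x i - g q i - \<gamma> i * (g x n - g q n) = (\<Sum>j<n. a i j * (x j - q j - \<beta> j * (x n - q n)))"
      if "i < n" for i
      using that
      by (simp add: gi gn \<gamma>_def algebra_simps sum.distrib sum_subtractf sum_distrib_left sum_distrib_right)
    then have "L2_set (\<lambda>i. g x i - g q i - \<gamma> i * (g x n - g q n)) {..<n} =
        L2_set (\<lambda>i. \<Sum>j<n. a i j * (x j - q j - \<beta> j * (x n - q n))) {..<n}"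
      by (intro L2_set_cong) simp_all
    then show ?thesis using L2_set_orthogonal[OF orth] by simp
  qed
  then have "\<forall>x\<in>topspace (Euclidean_space (Suc n)). x \<in> scyl n q \<beta> r e \<longleftrightarrow> g x \<in> scyl n (g q) \<gamma> r e"
    using Lu_star_in_topspace[OF assms] by (simp add: scyl_def gn)
  then show ?thesis by (rule that)
qed

lemma scyl_subset_obox: "scyl n y (\<lambda>_. 0) r r \<subseteq> obox (Suc n) y r"
proof
  fix x assume x: "x \<in> scyl n y (\<lambda>_. 0) r r"
  have "\<bar>x i - y i\<bar> < r" if "i < Suc n" for i
  proof (cases "i = n")
    case True
    then show ?thesis using x by (simp add: scyl_def)
  next
    case False
    then have "\<bar>x i - y i\<bar> \<le> L2_set (\<lambda>i. \<bar>x i - y i\<bar>) {..<n}"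
      using that by (intro member_le_L2_set) auto
    also have "\<dots> = L2_set (\<lambda>i. x i - y i) {..<n}" by (simp add: L2_set_def)
    also have "\<dots> < r" using x by (simp add: scyl_def)
    finally show ?thesis .
  qed
  then show "x \<in> obox (Suc n) y r" using x by (simp add: scyl_def obox_def)
qed

section \<open>Developing maps\<close>

lemma developing_map_local:
  assumes dev: "developing_map G A E \<pi> D" and gx: "gx_structure m G N A"
    and u: "u \<in> topspace E"
  obtains W U \<phi> g where "openin E W" "u \<in> W" "is_chart m N (U, \<phi>)" "(U, \<phi>) \<in> A" "g \<in> G"
    "\<pi> ` W \<subseteq> U" "\<forall>w\<in>W. D w = g (\<phi> (\<pi> w))"
proof -
  have "\<exists>W. openin E W \<and> u \<in> W \<and> (\<exists>(U, \<phi>)\<in>A. \<exists>g\<in>G. \<pi> ` W \<subseteq> U \<and> (\<forall>w\<in>W. D w = g (\<phi> (\<pi> w))))"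
    using dev u by (simp add: developing_map_def)
  then obtain W U \<phi> g where "openin E W" "u \<in> W" "(U, \<phi>) \<in> A" "g \<in> G" "\<pi> ` W \<subseteq> U"
      "\<forall>w\<in>W. D w = g (\<phi> (\<pi> w))" by blast
  moreover have "is_chart m N (U, \<phi>)" using gx \<open>(U, \<phi>) \<in> A\<close> by (simp add: gx_structure_def)
  ultimately show ?thesis using that by metis
qed

lemma continuous_map_Lu_star:
  assumes "g \<in> Lu_star n"
  shows "continuous_map (Euclidean_space (Suc n)) (Euclidean_space (Suc n)) g"
proof -
  have "continuous_map (subtopology (Euclidean_space (Suc n)) (topspace (Euclidean_space (Suc n))))
      (Euclidean_space (Suc n)) g"
    unfolding cm_Euclidean_space_iff_continuous_on
    using Lu_star_in_topspace[OF assms] continuous_on_subset[OF Lu_star_continuous[OF assms]] by simp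
  then show ?thesis by simp
qed

lemma continuous_map_chart:
  assumes "is_chart m N (U, \<phi>)"
  shows "continuous_map (subtopology N U) (Euclidean_space m) \<phi>"
  using assms homeomorphic_imp_continuous_map continuous_map_into_fulltopology
  by (fastforce simp: is_chart_def)

lemma inj_on_chart:
  assumes "is_chart m N (U, \<phi>)"
  shows "inj_on \<phi> U"
proof -
  obtain \<eta> where "\<forall>p\<in>U. \<eta> (\<phi> p) = p" using chart_inverse[OF assms] by metis
  then show ?thesis by (metis inj_onI)
qed

lemma developing_map_continuous:
  assumes dev: "developing_map (Lu_star n) A E \<pi> D" and gx: "gx_structure (Suc n) (Lu_star n) N A"
    and \<pi>: "continuous_map E N \<pi>"
  shows "continuous_map E (Euclidean_space (Suc n)) D"
proof -
  let ?X = "Euclidean_space (Suc n)"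
  have ex: "\<exists>W. openin E W \<and> u \<in> W \<and> continuous_map (subtopology E W) ?X D" if u: "u \<in> topspace E" for u
  proof -
    obtain W U \<phi> g where W: "openin E W" "u \<in> W" and U: "is_chart (Suc n) N (U, \<phi>)" and "(U, \<phi>) \<in> A"
        and g: "g \<in> Lu_star n" and WU: "\<pi> ` W \<subseteq> U" and D: "\<forall>w\<in>W. D w = g (\<phi> (\<pi> w))"
      by (rule developing_map_local[OF dev gx u])
    have "continuous_map (subtopology E W) (subtopology N U) \<pi>"
      using continuous_map_from_subtopology[OF \<pi>, of W] WU
      by (auto simp: continuous_map_in_subtopology)
    from continuous_map_compose[OF continuous_map_compose[OF this continuous_map_chart[OF U]]
        continuous_map_Lu_star[OF g]]
    have "continuous_map (subtopology E W) ?X D"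
      by (rule continuous_map_eq) (simp add: D)
    then show ?thesis using W by blast
  qed
  then obtain W where W: "\<forall>u\<in>topspace E. openin E (W u) \<and> u \<in> W u \<and> continuous_map (subtopology E (W u)) ?X D"
    by metis
  show ?thesis
    by (rule pasting_lemma[where I="topspace E" and T=W and f="\<lambda>_. D"]) (use W in auto)
qed

lemma developing_map_locally_injective:
  assumes dev: "developing_map (Lu_star n) A E \<pi> D" and gx: "gx_structure (Suc n) (Lu_star n) N A"
    and \<pi>: "locally_injective E \<pi>"
  shows "locally_injective E D"
  unfolding locally_injective_def
proof
  fix u assume u: "u \<in> topspace E"
  obtain W U \<phi> g where W: "openin E W" "u \<in> W" and U: "is_chart (Suc n) N (U, \<phi>)" and "(U, \<phi>) \<in> A"
      and g: "g \<in> Lu_star n" and WU: "\<pi> ` W \<subseteq> U" and D: "\<forall>w\<in>W. D w = g (\<phi> (\<pi> w))"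
    by (rule developing_map_local[OF dev gx u])
  obtain W' where W': "openin E W'" "u \<in> W'" "inj_on \<pi> W'"
    using \<pi> u unfolding locally_injective_def by blast
  obtain h where h: "\<forall>x\<in>topspace (Euclidean_space (Suc n)). h (g x) = x"
    using Lu_star_inverse[OF g] by metis
  have "openin (Euclidean_space (Suc n)) (\<phi> ` U)" using U by (simp add: is_chart_def)
  then have \<phi>U: "\<phi> ` U \<subseteq> topspace (Euclidean_space (Suc n))" by (rule openin_subset)
  have "inj_on D (W \<inter> W')"
  proof (rule inj_onI)
    fix x y assume x: "x \<in> W \<inter> W'" and y: "y \<in> W \<inter> W'" and eq: "D x = D y"
    have \<pi>U: "\<pi> x \<in> U" "\<pi> y \<in> U" using x y WU by auto
    have "g (\<phi> (\<pi> x)) = g (\<phi> (\<pi> y))" using x y eq D by simp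
    then have "h (g (\<phi> (\<pi> x))) = h (g (\<phi> (\<pi> y)))" by simp
    then have "\<phi> (\<pi> x) = \<phi> (\<pi> y)" using h \<phi>U \<pi>U by (simp add: image_subset_iff)
    then have "\<pi> x = \<pi> y" using inj_on_chart[OF U] \<pi>U by (simp add: inj_on_def)
    then show "x = y" using W'(3) x y by (simp add: inj_on_def)
  qed
  then show "\<exists>W. openin E W \<and> u \<in> W \<and> inj_on D W"
    using W W' openin_Int by blast
qed

text \<open>Let \<open>\<sigma>\<close> be the lift to \<open>E\<close> of the inverse of \<open>\<xi>\<close> on the open box. Near each point, \<open>D \<circ> \<sigma>\<close> is a product
  of two elements of the group, so by rigidity it is one such product \<open>h\<close> on the entire box. Then
  \<open>\<sigma>\<close> after the inverse of \<open>h\<close> is a section of \<open>D\<close>, and \<open>h\<close> maps the round cylinder in the box to a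
  sheared cylinder of the same radius and height.\<close>

lemma developing_map_section:
  assumes cov: "covering_map E \<pi> N" and N: "Hausdorff_space N"
    and gx: "gx_structure (Suc n) (Lu_star n) N A" and dev: "developing_map (Lu_star n) A E \<pi> D"
    and u: "u \<in> topspace E" and chart: "(C, \<xi>) \<in> A" "\<pi> u \<in> C" and "0 < \<epsilon>"
    and box: "closed_box (Suc n) (\<xi> (\<pi> u)) \<epsilon> \<subseteq> \<xi> ` C"
  obtains \<beta> \<tau> where "section_over E D (Euclidean_space (Suc n)) (scyl n (D u) \<beta> \<epsilon> \<epsilon>) \<tau>" "\<tau> (D u) = u"
proof -
  let ?X = "Euclidean_space (Suc n)"
  define y where "y = \<xi> (\<pi> u)"
  have C: "is_chart (Suc n) N (C, \<xi>)" using gx chart(1) by (simp add: gx_structure_def)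
  have yX: "y \<in> topspace ?X"
    using C chart(2) openin_subset[of ?X "\<xi> ` C"] by (auto simp: is_chart_def y_def)
  obtain \<sigma> where \<sigma>: "continuous_map (subtopology ?X (obox (Suc n) y \<epsilon>)) E \<sigma>"
    "\<forall>x\<in>obox (Suc n) y \<epsilon>. \<pi> (\<sigma> x) \<in> C \<and> \<xi> (\<pi> (\<sigma> x)) = x" "\<sigma> y = u"
    unfolding y_def by (rule lift_box_in_chart[OF cov N C u chart(2) \<open>0 < \<epsilon>\<close> box])
  let ?\<Omega> = "obox (Suc n) y \<epsilon>"
  have y\<Omega>: "y \<in> ?\<Omega>" by (rule center_in_obox[OF yX \<open>0 < \<epsilon>\<close>])
  have top\<Omega>: "topspace (subtopology ?X ?\<Omega>) = ?\<Omega>" using obox_subset by auto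
  \<comment> \<open>\<open>g'\<close> changes from \<open>\<xi>\<close> to the chart that describes \<open>D\<close> near a point, \<open>g\<close> is the element of the
    group in that description\<close>
  define H where "H = {(\<lambda>x. g (g' x)) | g g'. g \<in> Lu_star n \<and> g' \<in> Lu_star n}"
  have loc: "\<exists>W h. openin ?X W \<and> x \<in> W \<and> h \<in> H \<and> (\<forall>z\<in>W. (D \<circ> \<sigma>) z = h z)" if x: "x \<in> ?\<Omega>" for x
  proof -
    have "\<sigma> x \<in> topspace E" using \<sigma>(1) x top\<Omega> by (auto simp: continuous_map_def Pi_iff)
    then obtain W U \<phi> g where W: "openin E W" "\<sigma> x \<in> W" and "is_chart (Suc n) N (U, \<phi>)"
        and U: "(U, \<phi>) \<in> A" and g: "g \<in> Lu_star n" and WU: "\<pi> ` W \<subseteq> U"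
        and D: "\<forall>w\<in>W. D w = g (\<phi> (\<pi> w))"
      by (rule developing_map_local[OF dev gx])
    obtain g' where g': "g' \<in> Lu_star n" "\<forall>p\<in>C \<inter> U. \<phi> p = g' (\<xi> p)"
      using gx chart(1) U unfolding gx_structure_def by blast
    let ?W = "{z \<in> topspace (subtopology ?X ?\<Omega>). \<sigma> z \<in> W}"
    have "openin (subtopology ?X ?\<Omega>) ?W" by (rule openin_continuous_map_preimage[OF \<sigma>(1) W(1)])
    then have "openin ?X ?W" by (rule openin_trans_full[OF _ openin_obox])
    moreover have "x \<in> ?W" using x W(2) unfolding top\<Omega> by simp
    moreover have "(\<lambda>x. g (g' x)) \<in> H" using g g'(1) by (auto simp: H_def)
    moreover have "\<forall>z\<in>?W. (D \<circ> \<sigma>) z = g (g' z)"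
    proof
      fix z assume "z \<in> ?W"
      then have z: "z \<in> ?\<Omega>" "\<sigma> z \<in> W" unfolding top\<Omega> by auto
      then have "\<pi> (\<sigma> z) \<in> C \<inter> U" using \<sigma>(2) WU z by blast
      then have "D (\<sigma> z) = g (g' (\<xi> (\<pi> (\<sigma> z))))" using D z(2) g'(2) by simp
      then show "(D \<circ> \<sigma>) z = g (g' z)" using \<sigma>(2) z(1) by simp
    qed
    ultimately show ?thesis by (intro exI conjI)
  qed
  have aff: "affine_on_segments h" if "h \<in> H" for h
    using that affine_on_segments_comp Lu_star_affine by (auto simp: H_def)
  obtain h0 where h0: "h0 \<in> H" "\<forall>x\<in>?\<Omega>. (D \<circ> \<sigma>) x = h0 x"
    by (rule locally_affine_imp_affine[OF openin_obox cvx_obox y\<Omega> aff loc])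
  then obtain g g' where g: "g \<in> Lu_star n" "g' \<in> Lu_star n" "h0 = (\<lambda>x. g (g' x))"
    unfolding H_def by blast
  have Du: "D u = g (g' y)" using h0(2) y\<Omega> \<sigma>(3) g(3) by auto
  obtain \<beta>' where \<beta>': "\<forall>x\<in>topspace ?X. x \<in> scyl n y (\<lambda>_. 0) \<epsilon> \<epsilon> \<longleftrightarrow> g' x \<in> scyl n (g' y) \<beta>' \<epsilon> \<epsilon>"
    by (rule Lu_star_scyl[OF g(2)])
  obtain \<beta> where \<beta>: "\<forall>x\<in>topspace ?X. x \<in> scyl n (g' y) \<beta>' \<epsilon> \<epsilon> \<longleftrightarrow> g x \<in> scyl n (g (g' y)) \<beta> \<epsilon> \<epsilon>"
    by (rule Lu_star_scyl[OF g(1)])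
  obtain k where k: "continuous_on UNIV k" "k ` topspace ?X \<subseteq> topspace ?X"
    "\<forall>x\<in>topspace ?X. k (g x) = x" "\<forall>y\<in>topspace ?X. g (k y) = y"
    by (rule Lu_star_inverse[OF g(1)])
  obtain k' where k': "continuous_on UNIV k'" "k' ` topspace ?X \<subseteq> topspace ?X"
    "\<forall>x\<in>topspace ?X. k' (g' x) = x" "\<forall>y\<in>topspace ?X. g' (k' y) = y"
    by (rule Lu_star_inverse[OF g(2)])
  let ?S = "scyl n (D u) \<beta> \<epsilon> \<epsilon>"
  have inv: "k' (k x) \<in> ?\<Omega> \<and> g (g' (k' (k x))) = x" if x: "x \<in> ?S" for x
  proof -
    have xX: "x \<in> topspace ?X" using x scyl_subset by blast
    then have kx: "k x \<in> topspace ?X" using k(2) by blast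
    then have k'x: "k' (k x) \<in> topspace ?X" using k'(2) by blast
    have eq: "g (g' (k' (k x))) = x" using k(4) k'(4) xX kx by simp
    have "k x \<in> scyl n (g' y) \<beta>' \<epsilon> \<epsilon>" using \<beta> kx k(4) xX x by (simp add: Du)
    then have "k' (k x) \<in> scyl n y (\<lambda>_. 0) \<epsilon> \<epsilon>" using \<beta>' k'x k'(4) kx by simp
    then show ?thesis using scyl_subset_obox eq by blast
  qed
  have "continuous_map (subtopology ?X ?S) (subtopology ?X ?\<Omega>) (\<lambda>x. k' (k x))"
    unfolding continuous_map_in_subtopology
  proof
    have "continuous_on UNIV (\<lambda>x. k' (k x))"
      using continuous_on_compose2[OF k'(1) k(1)] by simp
    moreover have "k' (k x) \<in> topspace ?X" if "x \<in> topspace ?X" for x using that k(2) k'(2) by blast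
    ultimately show "continuous_map (subtopology ?X ?S) ?X (\<lambda>x. k' (k x))"
      unfolding cm_Euclidean_space_iff_continuous_on using continuous_on_subset by fastforce
    show "(\<lambda>x. k' (k x)) \<in> topspace (subtopology ?X ?S) \<rightarrow> ?\<Omega>" using inv by auto
  qed
  from continuous_map_compose[OF this \<sigma>(1)]
  have "continuous_map (subtopology ?X ?S) E (\<lambda>x. \<sigma> (k' (k x)))" by (simp add: o_def)
  moreover have "\<forall>x\<in>?S. D (\<sigma> (k' (k x))) = x"
  proof
    fix x assume "x \<in> ?S"
    then have "k' (k x) \<in> ?\<Omega>" "g (g' (k' (k x))) = x" using inv by blast+
    then show "D (\<sigma> (k' (k x))) = x" using h0(2) g(3) by simp
  qed
  ultimately have "section_over E D ?X ?S (\<lambda>x. \<sigma> (k' (k x)))"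
    using openin_scyl by (simp add: section_over_def)
  moreover have "\<sigma> (k' (k (D u))) = u"
    using k(3) k'(3) yX Lu_star_in_topspace[OF g(2)] \<sigma>(3) by (simp add: Du)
  ultimately show ?thesis by (rule that)
qed

section \<open>Plaques\<close>

lemma xpart_in_topspace:
  "z \<in> topspace (Euclidean_space (k + d)) \<Longrightarrow> xpart k z \<in> topspace (Euclidean_space d)"
  by (simp add: xpart_def topspace_Euclidean_space)

definition tx_join :: "nat \<Rightarrow> (nat \<Rightarrow> real) \<Rightarrow> (nat \<Rightarrow> real) \<Rightarrow> nat \<Rightarrow> real" where
  "tx_join k t x = (\<lambda>i. if i < k then t i else x (i - k))"

lemma xpart_tx_join [simp]: "xpart k (tx_join k t x) = x"
  by (simp add: xpart_def tx_join_def)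

lemma tpart_tx_join [simp]: "tpart k (tx_join k (tpart k z) x) = tpart k z"
  by (auto simp: tpart_def tx_join_def)

lemma tx_join_parts [simp]: "tx_join k (tpart k z) (xpart k z) = z"
  by (auto simp: tpart_def xpart_def tx_join_def)

lemma tx_join_in_topspace:
  "x \<in> topspace (Euclidean_space d) \<Longrightarrow> tx_join k t x \<in> topspace (Euclidean_space (k + d))"
  by (auto simp: topspace_Euclidean_space tx_join_def)

lemma continuous_map_xpart: "continuous_map (Euclidean_space (k + d)) (Euclidean_space d) (xpart k)"
proof -
  have "continuous_on UNIV (xpart k)"
    unfolding xpart_def
    by (intro continuous_on_coordinatewise_then_product continuous_on_product_coordinates)
  then have "continuous_map (subtopology (Euclidean_space (k + d)) (topspace (Euclidean_space (k + d))))
      (Euclidean_space d) (xpart k)"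
    unfolding cm_Euclidean_space_iff_continuous_on
    by (auto simp: xpart_in_topspace intro: continuous_on_subset)
  then show ?thesis by simp
qed

lemma continuous_map_tx_join: "continuous_map (Euclidean_space d) (Euclidean_space (k + d)) (tx_join k t)"
proof -
  have "continuous_on UNIV (tx_join k t)"
  proof (rule continuous_on_coordinatewise_then_product)
    fix i show "continuous_on UNIV (\<lambda>x. tx_join k t x i)"
      by (cases "i < k") (simp_all add: tx_join_def)
  qed
  then have "continuous_map (subtopology (Euclidean_space d) (topspace (Euclidean_space d)))
      (Euclidean_space (k + d)) (tx_join k t)"
    unfolding cm_Euclidean_space_iff_continuous_on
    by (auto simp: tx_join_in_topspace intro: continuous_on_subset)
  then show ?thesis by simp
qed

lemma local_leaf_subset: "C \<in> local_leaves M L U \<Longrightarrow> C \<subseteq> L \<inter> U \<and> C \<subseteq> topspace M"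
  unfolding local_leaves_def by (drule path_components_of_subset) simp

lemma local_leaf_nonempty: "C \<in> local_leaves M L U \<Longrightarrow> C \<noteq> {}"
  unfolding local_leaves_def by (rule nonempty_path_components_of)

lemma local_leaf_path_connectedin: "C \<in> local_leaves M L U \<Longrightarrow> path_connectedin M C"
  unfolding local_leaves_def using path_connectedin_path_components_of path_connectedin_subtopology by blast

lemma local_leaf_maximal:
  assumes C: "C \<in> local_leaves M L U" and S: "path_connectedin M S" "S \<subseteq> L \<inter> U" and p: "p \<in> C" "p \<in> S"
  shows "S \<subseteq> C"
proof (rule path_components_of_maximal)
  show "C \<in> path_components_of (subtopology M (L \<inter> U))" using C by (simp add: local_leaves_def)
  show "path_connectedin (subtopology M (L \<inter> U)) S" using S by (simp add: path_connectedin_subtopology)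
  show "\<not> disjnt C S" using p by (auto simp: disjnt_def)
qed

lemma local_leaf_exists:
  assumes "p \<in> L" "p \<in> U" "p \<in> topspace M"
  obtains C where "C \<in> local_leaves M L U" "p \<in> C"
proof -
  have "p \<in> \<Union>(path_components_of (subtopology M (L \<inter> U)))"
    unfolding Union_path_components_of using assms by simp
  then show ?thesis using that by (auto simp: local_leaves_def)
qed

lemma local_leaf_unique:
  assumes C: "C \<in> local_leaves M L U" and C': "C' \<in> local_leaves M L U" and p: "p \<in> C" "p \<in> C'"
  shows "C = C'"
proof
  show "C \<subseteq> C'"
    using local_leaf_maximal[OF C' local_leaf_path_connectedin[OF C]] local_leaf_subset[OF C] p by blast
  show "C' \<subseteq> C"
    using local_leaf_maximal[OF C local_leaf_path_connectedin[OF C']] local_leaf_subset[OF C'] p by blast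
qed

lemma plaque:
  assumes c: "maps_leaves_to_levels k d M F (U, \<phi>)" and "L \<in> F" and C: "C \<in> local_leaves M L U"
    and p: "p \<in> C"
  obtains V where "openin (Euclidean_space d) V"
    "\<phi> ` C = {z \<in> topspace (Euclidean_space (k + d)). tpart k z = tpart k (\<phi> p) \<and> xpart k z \<in> V}"
proof -
  obtain t V where V: "openin (Euclidean_space d) V"
      "\<phi> ` C = {z \<in> topspace (Euclidean_space (k + d)). tpart k z = t \<and> xpart k z \<in> V}"
    using c \<open>L \<in> F\<close> C unfolding maps_leaves_to_levels_def by blast
  moreover have "\<phi> p \<in> \<phi> ` C" using p by blast
  ultimately have "t = tpart k (\<phi> p)" by simp
  then show ?thesis using that V by simp
qed

lemma plaque_image:
  assumes V: "openin (Euclidean_space d) V"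
    and img: "\<phi> ` C = {z \<in> topspace (Euclidean_space (k + d)). tpart k z = tpart k (\<phi> p) \<and> xpart k z \<in> V}"
  shows "(\<lambda>q. xpart k (\<phi> q)) ` C = V"
proof -
  have "(\<lambda>q. xpart k (\<phi> q)) ` C = xpart k ` \<phi> ` C" by (simp add: image_image)
  also have "\<dots> = V"
  proof
    show "xpart k ` \<phi> ` C \<subseteq> V" unfolding img by auto
    show "V \<subseteq> xpart k ` \<phi> ` C"
    proof
      fix x assume x: "x \<in> V"
      then have "x \<in> topspace (Euclidean_space d)" using openin_subset[OF V] by blast
      then have "tx_join k (tpart k (\<phi> p)) x \<in> \<phi> ` C"
        unfolding img using x tx_join_in_topspace by simp
      then show "x \<in> xpart k ` \<phi> ` C" by (metis image_eqI xpart_tx_join)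
    qed
  qed
  finally show ?thesis .
qed

text \<open>The inverse puts the constant transverse part back and applies the inverse of \<open>\<phi>\<close>.\<close>

lemma plaque_homeomorphic:
  assumes chart: "is_chart (k + d) M (U, \<phi>)" and CU: "C \<subseteq> U" and V: "openin (Euclidean_space d) V"
    and img: "\<phi> ` C = {z \<in> topspace (Euclidean_space (k + d)). tpart k z = tpart k (\<phi> p) \<and> xpart k z \<in> V}"
  shows "homeomorphic_map (subtopology M C) (subtopology (Euclidean_space d) V) (\<lambda>q. xpart k (\<phi> q))"
proof -
  obtain \<eta> where \<eta>: "section_over M \<phi> (Euclidean_space (k + d)) (\<phi> ` U) \<eta>" "\<forall>q\<in>U. \<eta> (\<phi> q) = q"
      "\<eta> ` \<phi> ` U = U"
    by (rule chart_inverse[OF chart])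
  have "openin M U" using chart by (simp add: is_chart_def)
  then have CM: "C \<subseteq> topspace M" using CU openin_subset by blast
  have VX: "V \<subseteq> topspace (Euclidean_space d)" by (rule openin_subset[OF V])
  have top: "topspace (subtopology M C) = C" "topspace (subtopology (Euclidean_space d) V) = V"
    using CM VX by auto
  let ?j = "tx_join k (tpart k (\<phi> p))"
  have j: "\<forall>x\<in>V. ?j x \<in> \<phi> ` C"
    unfolding img using VX tx_join_in_topspace by auto
  have \<phi>U: "continuous_map (subtopology M C) (Euclidean_space (k + d)) \<phi>"
    by (rule continuous_map_from_subtopology_mono[OF continuous_map_chart[OF chart] CU])
  have "continuous_map (subtopology M C) (Euclidean_space d) (\<lambda>q. xpart k (\<phi> q))"
    using continuous_map_compose[OF \<phi>U continuous_map_xpart] by (simp add: o_def)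
  then have 1: "continuous_map (subtopology M C) (subtopology (Euclidean_space d) V) (\<lambda>q. xpart k (\<phi> q))"
    unfolding continuous_map_in_subtopology top using plaque_image[OF V img] by auto
  have "continuous_map (subtopology (Euclidean_space d) V) (subtopology (Euclidean_space (k + d)) (\<phi> ` U)) ?j"
    unfolding continuous_map_in_subtopology top
    using continuous_map_from_subtopology[OF continuous_map_tx_join] j CU by blast
  moreover have "continuous_map (subtopology (Euclidean_space (k + d)) (\<phi> ` U)) M \<eta>"
    using \<eta>(1) by (simp add: section_over_def)
  ultimately have "continuous_map (subtopology (Euclidean_space d) V) M (\<lambda>x. \<eta> (?j x))"
    using continuous_map_compose by (fastforce simp: o_def)
  moreover have \<eta>j: "\<eta> (?j x) \<in> C \<and> \<phi> (\<eta> (?j x)) = ?j x" if x: "x \<in> V" for x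
  proof -
    obtain q where q: "q \<in> C" "?j x = \<phi> q" using bspec[OF j x] by blast
    then have "\<eta> (?j x) = q" using \<eta>(2) CU by auto
    then show ?thesis using q by simp
  qed
  ultimately have 2: "continuous_map (subtopology (Euclidean_space d) V) (subtopology M C) (\<lambda>x. \<eta> (?j x))"
    unfolding continuous_map_in_subtopology top by blast
  have "\<eta> (?j (xpart k (\<phi> q))) = q" if q: "q \<in> C" for q
  proof -
    have "\<phi> q \<in> \<phi> ` C" using q by blast
    then have "tpart k (\<phi> q) = tpart k (\<phi> p)" unfolding img by simp
    then have "?j (xpart k (\<phi> q)) = \<phi> q" using tx_join_parts[of k "\<phi> q"] by simp
    then show ?thesis using \<eta>(2) q CU by auto
  qed
  moreover have "xpart k (\<phi> (\<eta> (?j x))) = x" if "x \<in> V" for x using \<eta>j[OF that] by simp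
  ultimately have "homeomorphic_maps (subtopology M C) (subtopology (Euclidean_space d) V)
      (\<lambda>q. xpart k (\<phi> q)) (\<lambda>x. \<eta> (?j x))"
    unfolding homeomorphic_maps_def top using 1 2 by blast
  then show ?thesis using homeomorphic_map_maps by blast
qed

section \<open>The leaf topology\<close>

lemma openin_leaf_topology_local_leaf:
  "openin M W \<Longrightarrow> C \<in> local_leaves M L W \<Longrightarrow> openin (leaf_topology M L) C"
  unfolding leaf_topology_def by (rule topology_generated_by_Basis) blast

lemma openin_leaf_topology_Int:
  assumes "openin M W"
  shows "openin (leaf_topology M L) (L \<inter> W)"
proof -
  have "topspace (subtopology M (L \<inter> W)) = L \<inter> W" using openin_subset[OF assms] by auto
  then have "L \<inter> W = \<Union>(local_leaves M L W)"
    unfolding local_leaves_def Union_path_components_of by simp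
  also have "openin (leaf_topology M L) \<dots>"
    using openin_leaf_topology_local_leaf[OF assms] by blast
  finally show ?thesis .
qed

lemma topspace_leaf_topology:
  assumes "L \<subseteq> topspace M"
  shows "topspace (leaf_topology M L) = L"
proof
  show "topspace (leaf_topology M L) \<subseteq> L"
    unfolding leaf_topology_def topology_generated_by_topspace using local_leaf_subset by fastforce
  have "openin (leaf_topology M L) (L \<inter> topspace M)" by (rule openin_leaf_topology_Int) simp
  then show "L \<subseteq> topspace (leaf_topology M L)" using assms openin_subset by (metis inf.absorb1)
qed

lemma Hausdorff_leaf_topology:
  assumes "Hausdorff_space M" "L \<subseteq> topspace M"
  shows "Hausdorff_space (leaf_topology M L)"
  unfolding Hausdorff_space_def topspace_leaf_topology[OF assms(2)]
proof (intro allI impI)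
  fix x y assume xy: "x \<in> L \<and> y \<in> L \<and> x \<noteq> y"
  then obtain U V where "openin M U" "openin M V" "x \<in> U" "y \<in> V" "disjnt U V"
    using assms unfolding Hausdorff_space_def by (metis subsetD)
  then show "\<exists>U V. openin (leaf_topology M L) U \<and> openin (leaf_topology M L) V \<and> x \<in> U \<and> y \<in> V \<and> disjnt U V"
    using xy by (intro exI[of _ "L \<inter> U"] exI[of _ "L \<inter> V"]) (auto simp: openin_leaf_topology_Int disjnt_def)
qed

text \<open>The leaf topology is finer than the topology of \<open>M\<close> on the leaf, but on one plaque they agree: a
  point of a plaque \<open>C\<close> has in \<open>C \<inter> W\<close> path connected neighbourhoods for the topology of \<open>M\<close>, and these
  stay in one path component of \<open>L \<inter> W\<close>.\<close>

lemma subtopology_leaf_topology: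
  assumes U: "openin M U" and C: "C \<in> local_leaves M L U"
    and lpc: "locally_path_connected_space (subtopology M C)"
  shows "subtopology (leaf_topology M L) C = subtopology M C"
proof -
  have CLU: "C \<subseteq> L \<inter> U" "C \<subseteq> topspace M" using local_leaf_subset[OF C] by auto
  have topC: "topspace (subtopology M C) = C" using CLU by auto
  have Cop: "openin (leaf_topology M L) C" by (rule openin_leaf_topology_local_leaf[OF U C])
  have basis: "openin (subtopology M C) (D \<inter> C)" if W: "openin M W" and D: "D \<in> local_leaves M L W" for D W
  proof (subst openin_subopen, intro ballI)
    fix p assume p: "p \<in> D \<inter> C"
    then have "p \<in> W" using local_leaf_subset[OF D] by blast
    let ?Q = "Collect (path_component_of (subtopology (subtopology M C) (C \<inter> W)) p)"
    have op: "openin (subtopology M C) (C \<inter> W)" using W openin_subtopology_Int2 by blast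
    then have Q: "openin (subtopology M C) ?Q"
      using lpc p \<open>p \<in> W\<close> unfolding locally_path_connected_space_eq_open_path_component_of by blast
    have "path_connectedin (subtopology (subtopology M C) (C \<inter> W)) ?Q"
      by (rule path_connectedin_path_component_of)
    then have pc: "path_connectedin M ?Q" "?Q \<subseteq> C \<inter> W"
      by (auto simp: path_connectedin_subtopology)
    have pQ: "p \<in> ?Q"
      using p \<open>p \<in> W\<close> CLU by (simp add: path_component_of_refl) blast
    have "?Q \<subseteq> L \<inter> W" using pc(2) CLU(1) by blast
    then have "?Q \<subseteq> D" using local_leaf_maximal[OF D pc(1) _ _ pQ] p by blast
    then show "\<exists>T. openin (subtopology M C) T \<and> p \<in> T \<and> T \<subseteq> D \<inter> C"
      using Q pQ pc(2) by (intro exI[of _ ?Q]) blast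
  qed
  have 1: "openin (subtopology M C) (T \<inter> C)" if "openin (leaf_topology M L) T" for T
  proof -
    have "generate_topology_on (\<Union>W\<in>{W. openin M W}. local_leaves M L W) T"
      using that unfolding leaf_topology_def openin_topology_generated_by_iff .
    then show ?thesis
    proof induction
      case Empty then show ?case by simp
    next
      case (Int a b)
      then have "openin (subtopology M C) ((a \<inter> C) \<inter> (b \<inter> C))" by (intro openin_Int[of _ "a \<inter> C" "b \<inter> C"])
      moreover have "(a \<inter> C) \<inter> (b \<inter> C) = a \<inter> b \<inter> C" by blast
      ultimately show ?case by simp
    next
      case (UN K)
      then have "openin (subtopology M C) (\<Union>k\<in>K. k \<inter> C)" by blast
      then show ?case unfolding Int_Union2 .
    next
      case (Basis s) then show ?case using basis by blast
    qed
  qed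
  have 2: "openin (leaf_topology M L) (T \<inter> C)" if T: "openin M T" for T
  proof (subst openin_subopen, intro ballI)
    fix p assume p: "p \<in> T \<inter> C"
    then obtain D where D: "D \<in> local_leaves M L (T \<inter> U)" "p \<in> D"
      using local_leaf_exists[of p L "T \<inter> U" M] CLU by blast
    have DTU: "D \<subseteq> L \<inter> (T \<inter> U)" using local_leaf_subset[OF D(1)] by blast
    then have "D \<subseteq> C"
      using local_leaf_maximal[OF C local_leaf_path_connectedin[OF D(1)] _ _ D(2)] p by blast
    moreover have "openin (leaf_topology M L) D"
      by (rule openin_leaf_topology_local_leaf[OF openin_Int[OF T U] D(1)])
    ultimately show "\<exists>S. openin (leaf_topology M L) S \<and> p \<in> S \<and> S \<subseteq> T \<inter> C"
      using D(2) DTU by (intro exI[of _ D]) blast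
  qed
  show ?thesis
    unfolding topology_eq
  proof (intro allI iffI)
    fix S assume "openin (subtopology (leaf_topology M L) C) S"
    then obtain T where "openin (leaf_topology M L) T" "S = T \<inter> C" by (auto simp: openin_subtopology)
    then show "openin (subtopology M C) S" using 1 by simp
  next
    fix S assume "openin (subtopology M C) S"
    then obtain T where "openin M T" "S = T \<inter> C" by (auto simp: openin_subtopology)
    then show "openin (subtopology (leaf_topology M L) C) S"
      using 2 openin_open_subtopology[OF Cop] by auto
  qed
qed

lemma is_chart_leaf_topology:
  assumes chart: "is_chart (k + d) M (U, \<phi>)" and lv: "maps_leaves_to_levels k d M F (U, \<phi>)"
    and L: "L \<in> F" and C: "C \<in> local_leaves M L U"
  shows "is_chart d (leaf_topology M L) (C, \<lambda>q. xpart k (\<phi> q))"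
proof -
  have U: "openin M U" using chart by (simp add: is_chart_def)
  obtain p where p: "p \<in> C" using local_leaf_nonempty[OF C] by blast
  obtain V where V: "openin (Euclidean_space d) V"
    "\<phi> ` C = {z \<in> topspace (Euclidean_space (k + d)). tpart k z = tpart k (\<phi> p) \<and> xpart k z \<in> V}"
    by (rule plaque[OF lv L C p])
  have CU: "C \<subseteq> U" using local_leaf_subset[OF C] by blast
  have hom: "homeomorphic_map (subtopology M C) (subtopology (Euclidean_space d) V) (\<lambda>q. xpart k (\<phi> q))"
    by (rule plaque_homeomorphic[OF chart CU V])
  have "locally_path_connected_space (subtopology (Euclidean_space d) V)"
    by (rule locally_path_connected_space_open_subset[OF locally_path_connected_Euclidean_space V(1)])
  then have "locally_path_connected_space (subtopology M C)"
    using homeomorphic_locally_path_connected_space[OF homeomorphic_map_imp_homeomorphic_space[OF hom]] by simp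
  then have "subtopology (leaf_topology M L) C = subtopology M C"
    by (rule subtopology_leaf_topology[OF U C])
  then show ?thesis
    using hom V(1) openin_leaf_topology_local_leaf[OF U C]
    by (simp add: is_chart_def plaque_image[OF V])
qed

text \<open>The transverse part is constant on a plaque, so of the family \<open>g\<close> in a transition map only one
  member acts on it.\<close>

lemma gx_structure_leaf:
  assumes gx: "gx_foliated_manifold k d G M A F B" and L: "L \<in> F"
  shows "gx_structure d G (leaf_topology M L) (leaf_atlas k M B L)"
proof -
  have part: "partition_on (topspace M) F" and cover: "topspace M \<subseteq> (\<Union>c\<in>B. fst c)"
    using gx by (auto simp: gx_foliated_manifold_def foliation_def)
  have LM: "L \<subseteq> topspace M" using partition_onD1[OF part] L by blast
  have B: "is_chart (k + d) M c \<and> maps_leaves_to_levels k d M F c" if "c \<in> B" for c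
    using gx that by (simp add: gx_foliated_manifold_def diffeo_chart_def)
  have tr: "gx_transition k G c c'" if "c \<in> B" "c' \<in> B" for c c'
    using gx that by (simp add: gx_foliated_manifold_def)
  have charts: "\<forall>c\<in>leaf_atlas k M B L. is_chart d (leaf_topology M L) c"
  proof
    fix c assume "c \<in> leaf_atlas k M B L"
    then obtain C U \<phi> where c: "c = (C, \<lambda>p. xpart k (\<phi> p))" "(U, \<phi>) \<in> B" "C \<in> local_leaves M L U"
      unfolding leaf_atlas_def by blast
    show "is_chart d (leaf_topology M L) c"
      unfolding c(1) using is_chart_leaf_topology[OF _ _ L c(3)] B[OF c(2)] by blast
  qed
  have covers: "topspace (leaf_topology M L) \<subseteq> (\<Union>c\<in>leaf_atlas k M B L. fst c)"
    unfolding topspace_leaf_topology[OF LM]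
  proof
    fix p assume p: "p \<in> L"
    then have pM: "p \<in> topspace M" using LM by blast
    then obtain U \<phi> where U: "(U, \<phi>) \<in> B" "p \<in> U" using cover by fastforce
    obtain C where C: "C \<in> local_leaves M L U" "p \<in> C" by (rule local_leaf_exists[OF p U(2) pM])
    have "(C, \<lambda>p. xpart k (\<phi> p)) \<in> leaf_atlas k M B L"
      unfolding leaf_atlas_def using U(1) C(1) by blast
    then show "p \<in> (\<Union>c\<in>leaf_atlas k M B L. fst c)" using C(2) by force
  qed
  have transitions: "\<exists>g\<in>G. \<forall>q\<in>C \<inter> C'. xpart k (\<phi>' q) = g (xpart k (\<phi> q))"
    if c: "(U, \<phi>) \<in> B" "C \<in> local_leaves M L U" and c': "(U', \<phi>') \<in> B" "C' \<in> local_leaves M L U'"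
    for C U \<phi> C' U' \<phi>'
  proof -
    obtain h g where g: "\<forall>t. g t \<in> G"
      "\<forall>p\<in>U \<inter> U'. tpart k (\<phi>' p) = h (tpart k (\<phi> p)) \<and> xpart k (\<phi>' p) = g (tpart k (\<phi> p)) (xpart k (\<phi> p))"
      using tr[OF c(1) c'(1)] by (auto simp: gx_transition_def)
    obtain p where p: "p \<in> C" using local_leaf_nonempty[OF c(2)] by blast
    obtain V where V: "openin (Euclidean_space d) V"
      "\<phi> ` C = {z \<in> topspace (Euclidean_space (k + d)). tpart k z = tpart k (\<phi> p) \<and> xpart k z \<in> V}"
      using plaque[OF _ L c(2) p] B[OF c(1)] by blast
    have t: "tpart k (\<phi> q) = tpart k (\<phi> p)" if "q \<in> C" for q
    proof -
      have "\<phi> q \<in> \<phi> ` C" using that by blast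
      then show ?thesis unfolding V(2) by simp
    qed
    have "\<forall>q\<in>C \<inter> C'. xpart k (\<phi>' q) = g (tpart k (\<phi> p)) (xpart k (\<phi> q))"
    proof
      fix q assume q: "q \<in> C \<inter> C'"
      then have "q \<in> U \<inter> U'" using local_leaf_subset[OF c(2)] local_leaf_subset[OF c'(2)] by blast
      then show "xpart k (\<phi>' q) = g (tpart k (\<phi> p)) (xpart k (\<phi> q))" using g(2) t q by simp
    qed
    then show ?thesis using g(1) by blast
  qed
  have "\<forall>(C, \<xi>)\<in>leaf_atlas k M B L. \<forall>(C', \<xi>')\<in>leaf_atlas k M B L. \<exists>g\<in>G. \<forall>q\<in>C \<inter> C'. \<xi>' q = g (\<xi> q)"
    using transitions by (fastforce simp: leaf_atlas_def)
  with charts covers show ?thesis unfolding gx_structure_def by (intro conjI)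
qed

section \<open>A uniform size of plaques\<close>

lemma uniform_chart_size:
  assumes M: "compact_space M" and charts: "\<forall>c\<in>B. is_chart m M c" and cover: "topspace M \<subseteq> (\<Union>c\<in>B. fst c)"
  obtains \<delta> where "0 < \<delta>"
    "\<forall>q\<in>topspace M. \<exists>U \<phi>. (U, \<phi>) \<in> B \<and> q \<in> U \<and> obox m (\<phi> q) \<delta> \<subseteq> \<phi> ` U"
proof -
  let ?P = "\<lambda>q \<delta>. \<exists>U \<phi>. (U, \<phi>) \<in> B \<and> q \<in> U \<and> obox m (\<phi> q) \<delta> \<subseteq> \<phi> ` U"
  show ?thesis
  proof (rule compactin_uniform_radius[of M "topspace M" ?P])
    show "compactin M (topspace M)" using M by (simp add: compact_space_def)
    show "?P q \<delta>'" if "?P q \<delta>" "\<delta>' \<le> \<delta>" for q \<delta> \<delta>'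
      using that obox_mono by (meson subset_trans)
    fix p assume "p \<in> topspace M"
    then obtain U \<phi> where U: "(U, \<phi>) \<in> B" "p \<in> U" using cover by fastforce
    have ch: "is_chart m M (U, \<phi>)" using charts U(1) by blast
    then have op: "openin M U" "openin (Euclidean_space m) (\<phi> ` U)" by (simp_all add: is_chart_def)
    have topU: "topspace (subtopology M U) = U" using openin_subset[OF op(1)] by auto
    obtain \<delta> where \<delta>: "0 < \<delta>" "obox m (\<phi> p) \<delta> \<subseteq> \<phi> ` U"
      by (rule openin_contains_obox[OF op(2)]) (use U(2) in auto)
    let ?W = "{q \<in> topspace (subtopology M U). \<phi> q \<in> obox m (\<phi> p) (\<delta> / 2)}"
    have "openin (subtopology M U) ?W"
      by (rule openin_continuous_map_preimage[OF continuous_map_chart[OF ch] openin_obox])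
    then have W: "openin M ?W" by (rule openin_trans_full[OF _ op(1)])
    have "\<phi> p \<in> topspace (Euclidean_space m)" using openin_subset[OF op(2)] U(2) by blast
    then have pW: "p \<in> ?W" unfolding topU using U(2) \<delta>(1) center_in_obox half_gt_zero by blast
    have "?P q (\<delta> / 2)" if q: "q \<in> ?W" for q
    proof -
      have q': "q \<in> U" "\<phi> q \<in> obox m (\<phi> p) (\<delta> / 2)" using q unfolding topU by auto
      have "obox m (\<phi> q) (\<delta> / 2) \<subseteq> obox m (\<phi> p) \<delta>"
      proof
        fix x assume x: "x \<in> obox m (\<phi> q) (\<delta> / 2)"
        have "\<bar>x i - \<phi> p i\<bar> < \<delta>" if "i < m" for i
        proof -
          have "\<bar>x i - \<phi> q i\<bar> < \<delta> / 2" "\<bar>\<phi> q i - \<phi> p i\<bar> < \<delta> / 2"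
            using x q'(2) that by (simp_all add: obox_def)
          then show ?thesis by linarith
        qed
        then show "x \<in> obox m (\<phi> p) \<delta>" using x by (simp add: obox_def)
      qed
      then show ?thesis using U(1) q'(1) \<delta>(2) by blast
    qed
    then show "\<exists>W \<delta>. openin M W \<and> p \<in> W \<and> 0 < \<delta> \<and> (\<forall>q\<in>W. ?P q \<delta>)"
      using W pW \<delta>(1) by (intro exI[of _ ?W] exI[of _ "\<delta> / 2"]) simp
  qed (rule that)
qed

text \<open>The slice of the box through \<open>\<phi> p\<close> is connected, and the plaques of all leaves cut it into disjoint
  open pieces. Hence it lies in the plaque of \<open>p\<close>; a plaque of the same leaf at the same transverse
  part but elsewhere in the slice is excluded in this way too.\<close>

lemma plaque_contains_box:
  assumes part: "partition_on (topspace M) F" and L: "L \<in> F"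
    and chart: "is_chart (k + d) M (U, \<phi>)" and lv: "maps_leaves_to_levels k d M F (U, \<phi>)"
    and C: "C \<in> local_leaves M L U" "p \<in> C" and "0 < \<delta>" and box: "obox (k + d) (\<phi> p) \<delta> \<subseteq> \<phi> ` U"
  shows "obox d (xpart k (\<phi> p)) \<delta> \<subseteq> (\<lambda>q. xpart k (\<phi> q)) ` C"
proof -
  let ?X = "Euclidean_space d" and ?y = "xpart k (\<phi> p)" and ?t = "tpart k (\<phi> p)"
  obtain V where V: "openin ?X V"
    "\<phi> ` C = {z \<in> topspace (Euclidean_space (k + d)). tpart k z = ?t \<and> xpart k z \<in> V}"
    by (rule plaque[OF lv L C])
  have op: "openin M U" "openin (Euclidean_space (k + d)) (\<phi> ` U)" using chart by (simp_all add: is_chart_def)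
  have pU: "p \<in> U" using local_leaf_subset[OF C(1)] C(2) by blast
  then have "\<phi> p \<in> topspace (Euclidean_space (k + d))" using openin_subset[OF op(2)] by blast
  then have yX: "?y \<in> topspace ?X" by (rule xpart_in_topspace)
  have yV: "?y \<in> V"
  proof -
    have "\<phi> p \<in> \<phi> ` C" using C(2) by blast
    then show ?thesis unfolding V(2) by simp
  qed
  have "obox d ?y \<delta> \<subseteq> V"
  proof (rule connectedin_subset_if_separated[OF connectedin_cvx[OF cvx_obox obox_subset] V(1)
        center_in_obox[OF yX \<open>0 < \<delta>\<close>] yV])
    fix x assume x: "x \<in> obox d ?y \<delta>" "x \<notin> V"
    have xX: "x \<in> topspace ?X" using x(1) obox_subset by blast
    let ?z = "tx_join k ?t x"
    have "\<bar>?z i - \<phi> p i\<bar> < \<delta>" if "i < k + d" for i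
      using x(1) that \<open>0 < \<delta>\<close> by (cases "i < k") (auto simp: tx_join_def tpart_def obox_def xpart_def dest: spec[of _ "i - k"])
    then have "?z \<in> obox (k + d) (\<phi> p) \<delta>" using tx_join_in_topspace[OF xX] by (simp add: obox_def)
    then obtain q where q: "q \<in> U" "\<phi> q = ?z" using box by (metis image_iff subsetD)
    then have qM: "q \<in> topspace M" using openin_subset[OF op(1)] by blast
    then obtain L' where L': "L' \<in> F" "q \<in> L'" using partition_onD1[OF part] by blast
    obtain C' where C': "C' \<in> local_leaves M L' U" "q \<in> C'" by (rule local_leaf_exists[OF L'(2) q(1) qM])
    obtain V' where V': "openin ?X V'"
      "\<phi> ` C' = {z \<in> topspace (Euclidean_space (k + d)). tpart k z = tpart k (\<phi> q) \<and> xpart k z \<in> V'}"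
      by (rule plaque[OF lv L'(1) C'])
    have tq: "tpart k (\<phi> q) = ?t" unfolding q(2) by simp
    have xV': "x \<in> V'"
    proof -
      have "\<phi> q \<in> \<phi> ` C'" using C'(2) by blast
      then show ?thesis unfolding V'(2) q(2) by simp
    qed
    have "V' \<inter> V = {}"
    proof (rule ccontr)
      assume "V' \<inter> V \<noteq> {}"
      then obtain v where v: "v \<in> V" "v \<in> V'" by blast
      then have "v \<in> topspace ?X" using openin_subset[OF V(1)] by blast
      then have jv: "tx_join k ?t v \<in> topspace (Euclidean_space (k + d))" by (rule tx_join_in_topspace)
      then have "tx_join k ?t v \<in> \<phi> ` C" unfolding V(2) using v by simp
      moreover have "tx_join k ?t v \<in> \<phi> ` C'" unfolding V'(2) tq using v jv by simp
      ultimately obtain a b where ab: "a \<in> C" "b \<in> C'" "\<phi> a = \<phi> b" by (metis imageE)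
      then have "a \<in> U" "b \<in> U" using local_leaf_subset[OF C(1)] local_leaf_subset[OF C'(1)] by blast+
      then have "a = b" using inj_on_chart[OF chart] ab(3) by (simp add: inj_on_def)
      then have "a \<in> L" "a \<in> L'" using ab local_leaf_subset[OF C(1)] local_leaf_subset[OF C'(1)] by blast+
      then have "L' = L" using partition_onD2[OF part] L L'(1) by (auto simp: disjoint_def)
      then have "C' = C" using local_leaf_unique[OF _ C(1), of C' a] C'(1) ab \<open>a = b\<close> by simp
      then have "\<phi> q \<in> \<phi> ` C" using C'(2) by simp
      then have "x \<in> V" unfolding V(2) q(2) by simp
      then show False using x(2) by simp
    qed
    then show "\<exists>T. openin ?X T \<and> x \<in> T \<and> T \<inter> V = {}" using V'(1) xV' by blast
  qed
  then show ?thesis unfolding plaque_image[OF V] .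
qed

theorem theorem1p11:
  fixes M :: "'m topology" and A B :: "'m chart set" and F :: "'m set set" and n k :: nat
  assumes "compact_space M"
    and "gx_foliated_manifold k (Suc n) (Lu_star n) M A F B"
    and "L \<in> F"
  shows "gx_complete TYPE('u) (Suc n) (Lu_star n) (leaf_topology M L) (leaf_atlas k M B L)"
proof -
  let ?N = "leaf_topology M L" and ?A = "leaf_atlas k M B L" and ?X = "Euclidean_space (Suc n)"
  have gx: "gx_structure (Suc n) (Lu_star n) ?N ?A"
    by (rule gx_structure_leaf[OF assms(2,3)])
  have part: "partition_on (topspace M) F" and cover: "topspace M \<subseteq> (\<Union>c\<in>B. fst c)"
      and HM: "Hausdorff_space M"
    using assms(2) by (simp_all add: gx_foliated_manifold_def foliation_def smooth_manifold_def)
  have B: "\<forall>c\<in>B. is_chart (k + Suc n) M c" "\<forall>c\<in>B. maps_leaves_to_levels k (Suc n) M F c"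
    using assms(2) by (simp_all add: gx_foliated_manifold_def diffeo_chart_def)
  have LM: "L \<subseteq> topspace M" using partition_onD1[OF part] assms(3) by blast
  have Lne: "L \<noteq> {}" using partition_onD3[OF part] assms(3) by blast
  have HN: "Hausdorff_space ?N" by (rule Hausdorff_leaf_topology[OF HM LM])
  have topN: "topspace ?N = L" by (rule topspace_leaf_topology[OF LM])
  obtain \<delta> where \<delta>: "0 < \<delta>"
    "\<forall>q\<in>topspace M. \<exists>U \<phi>. (U, \<phi>) \<in> B \<and> q \<in> U \<and> obox (k + Suc n) (\<phi> q) \<delta> \<subseteq> \<phi> ` U"
    by (rule uniform_chart_size[OF assms(1) B(1) cover])
  \<comment> \<open>a closed box is needed for lifting, which costs half of the radius\<close>
  have big: "\<exists>C \<xi>. (C, \<xi>) \<in> ?A \<and> q \<in> C \<and> closed_box (Suc n) (\<xi> q) (\<delta> / 2) \<subseteq> \<xi> ` C" if q: "q \<in> L" for q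
  proof -
    have qM: "q \<in> topspace M" using q LM by blast
    then obtain U \<phi> where U: "(U, \<phi>) \<in> B" "q \<in> U" "obox (k + Suc n) (\<phi> q) \<delta> \<subseteq> \<phi> ` U"
      using \<delta>(2) by blast
    obtain C where C: "C \<in> local_leaves M L U" "q \<in> C" by (rule local_leaf_exists[OF q U(2) qM])
    have "obox (Suc n) (xpart k (\<phi> q)) \<delta> \<subseteq> (\<lambda>p. xpart k (\<phi> p)) ` C"
      by (rule plaque_contains_box[OF part assms(3) bspec[OF B(1) U(1)] bspec[OF B(2) U(1)] C \<delta>(1) U(3)])
    moreover have "closed_box (Suc n) (xpart k (\<phi> q)) (\<delta> / 2) \<subseteq> obox (Suc n) (xpart k (\<phi> q)) \<delta>"
      using \<delta>(1) by (fastforce simp: closed_box_def obox_def)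
    moreover have "(C, \<lambda>p. xpart k (\<phi> p)) \<in> ?A" unfolding leaf_atlas_def using U(1) C(1) by blast
    ultimately show ?thesis using C(2) by (intro exI[of _ C] exI[of _ "\<lambda>p. xpart k (\<phi> p)"]) blast
  qed
  have "covering_map E D ?X"
    if cov: "universal_cover E \<pi> ?N" and dev: "developing_map (Lu_star n) ?A E \<pi> D"
    for E :: "'u topology" and \<pi> D
  proof -
    have cv: "covering_map E \<pi> ?N" using cov by (simp add: universal_cover_def)
    have \<pi>: "continuous_map E ?N \<pi>" "\<pi> ` topspace E = L"
      using cv by (simp_all add: covering_map_def topN)
    show ?thesis
    proof (rule covering_map_if_scyl_sections)
      show "Hausdorff_space E" by (rule covering_map_Hausdorff[OF cv HN])
      show "topspace E \<noteq> {}" using \<pi>(2) Lne by blast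
      show "continuous_map E ?X D" by (rule developing_map_continuous[OF dev gx \<pi>(1)])
      show "locally_injective E D"
        by (rule developing_map_locally_injective[OF dev gx covering_map_locally_injective[OF cv]])
      show "0 < \<delta> / 2" using \<delta>(1) by simp
      fix u assume u: "u \<in> topspace E"
      then have "\<pi> u \<in> L" using \<pi>(2) by blast
      then obtain C \<xi> where C: "(C, \<xi>) \<in> ?A" "\<pi> u \<in> C" "closed_box (Suc n) (\<xi> (\<pi> u)) (\<delta> / 2) \<subseteq> \<xi> ` C"
        using big by blast
      show "\<exists>\<beta> \<tau>. section_over E D ?X (scyl n (D u) \<beta> (\<delta> / 2) (\<delta> / 2)) \<tau> \<and> \<tau> (D u) = u"
        by (rule developing_map_section[OF cv HN gx dev u C(1,2) _ C(3)]) (use \<delta>(1) in auto)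
    qed
  qed
  then show ?thesis unfolding gx_complete_def using gx by (intro conjI allI impI) (assumption, elim conjE, assumption)
qed

end
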